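(* Let $\lambda \in \mathbb{C}$ and let $f \in C^{2}(\mathbb{D})$ satisfy $\Delta_{\mathbb{D}} f=\lambda f$ in $\mathbb{D}$. Then there is a uniquely determined function $F \in \mathcal{H}(\mathbb{D}^2)$ such that $\Delta_{zw}F=\lambda F$ on $\mathbb{D}^2$ and $f(z)=F(z,\overline{z})$ for all $z \in \mathbb{D}$. Moreover, the induced bijective linear map $X_{\lambda}(\mathbb{D}) \to X_{\lambda}(\mathbb{D}^2)$, $f \mapsto F$, is continuous.
   Context: $\mathbb{D}=\{z\in\mathbb{C}:|z|<1\}$ and $\mathbb{D}^2=\mathbb{D}\times\mathbb{D}$. $\mathcal{H}(\mathbb{D}^2)$ is the space of holomorphic functions $\mathbb{D}^2\to\mathbb{C}$; $C^2(\mathbb{D})$ is the space of twice continuously real differentiable functions $\mathbb{D}\to\mathbb{C}$. $\Delta_{\mathbb{D}}=4(1-|z|^2)^2\partial_z\partial_{\overline{z}}$ (Wirtinger derivatives) and $\Delta_{zw}=4(1-zw)^2\partial_z\partial_w$. $X_\lambda(\mathbb{D})=\{f\in C^2(\mathbb{D}):\Delta_{\mathbb{D}}f=\lambda f\}$ and $X_\lambda(\mathbb{D}^2)=\{F\in\mathcal{H}(\mathbb{D}^2):\Delta_{zw}F=\lambda F\}$, both equipped with the topology of locally uniform convergence (on $\mathbb{D}$ resp. $\mathbb{D}^2$). *)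

theory Defs
  imports "HOL-Analysis.Analysis"
begin

text \<open>
  A function on the disc or the bidisc is represented by the total function that takes the value
  \<^const>\<open>undefined\<close> outside it (\<^const>\<open>extensional\<close>), so that HOL equality of representatives is
  equality of functions on the domain. Both domains are open, so derivatives at their points
  do not see the values outside.
\<close>

abbreviation disc :: "complex set" where
  "disc \<equiv> ball 0 1"

abbreviation bidisc :: "(complex \<times> complex) set" where
  "bidisc \<equiv> disc \<times> disc"

text \<open>Real differentiability: \<^typ>\<open>complex\<close> is regarded as a real normed space and the Frechet
  derivatives are bounded real-linear maps.\<close>

definition C2_on :: "'a::real_normed_vector set \<Rightarrow> ('a \<Rightarrow> 'b::real_normed_vector) \<Rightarrow> bool" where
  "C2_on S f \<longleftrightarrow>
     (\<exists>(f' :: 'a \<Rightarrow> 'a \<Rightarrow>\<^sub>L 'b) (f'' :: 'a \<Rightarrow> 'a \<Rightarrow>\<^sub>L 'a \<Rightarrow>\<^sub>L 'b).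
        (\<forall>z\<in>S. (f has_derivative blinfun_apply (f' z)) (at z)) \<and>
        (\<forall>z\<in>S. (f' has_derivative blinfun_apply (f'' z)) (at z)) \<and>
        continuous_on S f'')"

definition wirtinger :: "(complex \<Rightarrow> complex) \<Rightarrow> complex \<Rightarrow> complex" where
  "wirtinger f z = (frechet_derivative f (at z) 1 - \<i> * frechet_derivative f (at z) \<i>) / 2"

definition wirtinger_bar :: "(complex \<Rightarrow> complex) \<Rightarrow> complex \<Rightarrow> complex" where
  "wirtinger_bar f z = (frechet_derivative f (at z) 1 + \<i> * frechet_derivative f (at z) \<i>) / 2"

definition laplace_disc :: "(complex \<Rightarrow> complex) \<Rightarrow> complex \<Rightarrow> complex" where
  "laplace_disc f z = 4 * (1 - of_real ((cmod z)\<^sup>2))\<^sup>2 * wirtinger (wirtinger_bar f) z"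

text \<open>Holomorphy in two variables: the real Frechet derivative exists at every point and is
  complex linear, i.e. of the form \<open>(h, k) \<mapsto> a h + b k\<close>. Meant for open sets.\<close>

definition holomorphic2_on :: "(complex \<times> complex \<Rightarrow> complex) \<Rightarrow> (complex \<times> complex) set \<Rightarrow> bool" where
  "holomorphic2_on F S \<longleftrightarrow>
     (\<forall>p\<in>S. \<exists>a b. (F has_derivative (\<lambda>(h, k). a * h + b * k)) (at p))"

definition laplace_zw :: "(complex \<times> complex \<Rightarrow> complex) \<Rightarrow> complex \<times> complex \<Rightarrow> complex" where
  "laplace_zw F = (\<lambda>(z, w). 4 * (1 - z * w)\<^sup>2 * deriv (\<lambda>u. deriv (\<lambda>v. F (u, v)) w) z)"

definition C2_disc :: "(complex \<Rightarrow> complex) set" where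
  "C2_disc = {f \<in> extensional disc. C2_on disc f}"

definition H_bidisc :: "(complex \<times> complex \<Rightarrow> complex) set" where
  "H_bidisc = {F \<in> extensional bidisc. holomorphic2_on F bidisc}"

definition X_disc :: "complex \<Rightarrow> (complex \<Rightarrow> complex) set" where
  "X_disc l = {f \<in> C2_disc. \<forall>z\<in>disc. laplace_disc f z = l * f z}"

definition X_bidisc :: "complex \<Rightarrow> (complex \<times> complex \<Rightarrow> complex) set" where
  "X_bidisc l = {F \<in> H_bidisc. \<forall>p\<in>bidisc. laplace_zw F p = l * F p}"

text \<open>The topology of locally uniform convergence on \<open>S\<close>, on a set \<open>X\<close> of functions: the sets
  \<open>{g \<in> X. \<forall>x\<in>K. dist (g x) (f x) < e}\<close> with \<open>K \<subseteq> S\<close> compact and \<open>e > 0\<close> form a basis of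
  neighbourhoods of \<open>f\<close>. The lemma \<open>limitin_locally_uniform_topology\<close> below shows that, for \<open>S\<close>
  open in a Euclidean space, convergence in it is locally uniform convergence.\<close>

definition locally_uniform_topology ::
    "'a::topological_space set \<Rightarrow> ('a \<Rightarrow> 'b::metric_space) set \<Rightarrow> ('a \<Rightarrow> 'b) topology" where
  "locally_uniform_topology S X = topology (\<lambda>U. U \<subseteq> X \<and>
     (\<forall>f\<in>U. \<exists>K e. compact K \<and> K \<subseteq> S \<and> e > 0 \<and>
        (\<forall>g\<in>X. (\<forall>x\<in>K. dist (g x) (f x) < e) \<longrightarrow> g \<in> U)))"

text \<open>The map \<open>f \<mapsto> F\<close>; meaningful for \<open>f \<in> X_disc l\<close>, where \<open>F\<close> exists and is unique.\<close>

definition extension_map :: "complex \<Rightarrow> (complex \<Rightarrow> complex) \<Rightarrow> complex \<times> complex \<Rightarrow> complex" where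
  "extension_map l f = (THE F. F \<in> X_bidisc l \<and> (\<forall>z\<in>disc. f z = F (z, cnj z)))"

lemma openin_locally_uniform_topology:
  "openin (locally_uniform_topology S X) U \<longleftrightarrow> U \<subseteq> X \<and>
     (\<forall>f\<in>U. \<exists>K e. compact K \<and> K \<subseteq> S \<and> e > 0 \<and>
        (\<forall>g\<in>X. (\<forall>x\<in>K. dist (g x) (f x) < e) \<longrightarrow> g \<in> U))"
proof -
  let ?P = "\<lambda>U. U \<subseteq> X \<and> (\<forall>f\<in>U. \<exists>K e. compact K \<and> K \<subseteq> S \<and> e > 0 \<and>
        (\<forall>g\<in>X. (\<forall>x\<in>K. dist (g x) (f x) < e) \<longrightarrow> g \<in> U))"
  have "istopology ?P"
    unfolding istopology_def
  proof (intro conjI allI impI)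
    fix U V assume U: "?P U" and V: "?P V"
    show "U \<inter> V \<subseteq> X" using U by blast
    show "\<forall>f\<in>U \<inter> V. \<exists>K e. compact K \<and> K \<subseteq> S \<and> e > 0 \<and>
        (\<forall>g\<in>X. (\<forall>x\<in>K. dist (g x) (f x) < e) \<longrightarrow> g \<in> U \<inter> V)"
    proof
      fix f assume f: "f \<in> U \<inter> V"
      obtain K e where 1: "compact K" "K \<subseteq> S" "e > 0"
          "\<And>g. g \<in> X \<Longrightarrow> (\<forall>x\<in>K. dist (g x) (f x) < e) \<Longrightarrow> g \<in> U"
        using U f by (metis IntD1)
      obtain L d where 2: "compact L" "L \<subseteq> S" "d > 0"
          "\<And>g. g \<in> X \<Longrightarrow> (\<forall>x\<in>L. dist (g x) (f x) < d) \<Longrightarrow> g \<in> V"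
        using V f by (metis IntD2)
      show "\<exists>K e. compact K \<and> K \<subseteq> S \<and> e > 0 \<and>
          (\<forall>g\<in>X. (\<forall>x\<in>K. dist (g x) (f x) < e) \<longrightarrow> g \<in> U \<inter> V)"
        by (rule exI[of _ "K \<union> L"], rule exI[of _ "min e d"]) (use 1 2 in auto)
    qed
  next
    fix \<U> assume *: "\<forall>U\<in>\<U>. ?P U"
    show "\<Union>\<U> \<subseteq> X" using * by blast
    show "\<forall>f\<in>\<Union>\<U>. \<exists>K e. compact K \<and> K \<subseteq> S \<and> e > 0 \<and>
        (\<forall>g\<in>X. (\<forall>x\<in>K. dist (g x) (f x) < e) \<longrightarrow> g \<in> \<Union>\<U>)"
    proof
      fix f assume "f \<in> \<Union>\<U>"
      then obtain U where U: "U \<in> \<U>" "f \<in> U" by blast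
      then obtain K e where "compact K" "K \<subseteq> S" "e > 0"
          "\<forall>g\<in>X. (\<forall>x\<in>K. dist (g x) (f x) < e) \<longrightarrow> g \<in> U"
        using * by metis
      with U show "\<exists>K e. compact K \<and> K \<subseteq> S \<and> e > 0 \<and>
          (\<forall>g\<in>X. (\<forall>x\<in>K. dist (g x) (f x) < e) \<longrightarrow> g \<in> \<Union>\<U>)" by blast
    qed
  qed
  then show ?thesis
    unfolding locally_uniform_topology_def by (simp add: topology_inverse')
qed

lemma topspace_locally_uniform_topology [simp]:
  "topspace (locally_uniform_topology S X) = X"
proof
  show "topspace (locally_uniform_topology S X) \<subseteq> X"
    by (auto simp: topspace_def openin_locally_uniform_topology)
  have "openin (locally_uniform_topology S X) X"
    unfolding openin_locally_uniform_topology
    by (auto intro!: exI[of _ "{}"] exI[of _ "1::real"])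
  then show "X \<subseteq> topspace (locally_uniform_topology S X)"
    by (rule openin_subset)
qed

lemma limitin_locally_uniform_topology_compact:
  assumes X: "eventually (\<lambda>n. f n \<in> X) F" and g: "g \<in> X"
  shows "limitin (locally_uniform_topology S X) f g F \<longleftrightarrow>
           (\<forall>K. compact K \<and> K \<subseteq> S \<longrightarrow> uniform_limit K f g F)"
proof
  assume lim: "limitin (locally_uniform_topology S X) f g F"
  show "\<forall>K. compact K \<and> K \<subseteq> S \<longrightarrow> uniform_limit K f g F"
  proof (intro allI impI uniform_limitI)
    fix K and e :: real assume K: "compact K \<and> K \<subseteq> S" and e: "e > 0"
    let ?U = "{h \<in> X. \<exists>d<e. \<forall>x\<in>K. dist (h x) (g x) \<le> d}"
    have "openin (locally_uniform_topology S X) ?U"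
      unfolding openin_locally_uniform_topology
    proof (intro conjI ballI)
      show "?U \<subseteq> X" by blast
      fix h assume "h \<in> ?U"
      then obtain d where d: "d < e" "\<forall>x\<in>K. dist (h x) (g x) \<le> d" by blast
      have "k \<in> ?U" if "k \<in> X" and k: "\<forall>x\<in>K. dist (k x) (h x) < (e - d) / 2" for k
      proof -
        have "dist (k x) (g x) \<le> (e + d) / 2" if "x \<in> K" for x
        proof -
          have "dist (k x) (g x) \<le> dist (k x) (h x) + dist (h x) (g x)"
            by (rule dist_triangle)
          also have "\<dots> \<le> (e - d) / 2 + d"
            using k d(2) that by (intro add_mono) (auto intro: less_imp_le)
          finally show ?thesis by (simp add: field_simps)
        qed
        then show ?thesis using d(1) \<open>k \<in> X\<close> by (auto intro!: exI[of _ "(e + d) / 2"])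
      qed
      then show "\<exists>K e. compact K \<and> K \<subseteq> S \<and> e > 0 \<and>
          (\<forall>k\<in>X. (\<forall>x\<in>K. dist (k x) (h x) < e) \<longrightarrow> k \<in> ?U)"
        using K d(1) by (intro exI[of _ K] exI[of _ "(e - d) / 2"]) auto
    qed
    moreover have "g \<in> ?U" using g e by (auto intro!: exI[of _ 0])
    ultimately have "eventually (\<lambda>n. f n \<in> ?U) F"
      using lim unfolding limitin_def by blast
    then show "\<forall>\<^sub>F n in F. \<forall>x\<in>K. dist (f n x) (g x) < e"
      by (rule eventually_mono) force
  qed
next
  assume *: "\<forall>K. compact K \<and> K \<subseteq> S \<longrightarrow> uniform_limit K f g F"
  show "limitin (locally_uniform_topology S X) f g F"
    unfolding limitin_def
  proof (intro conjI allI impI)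
    show "g \<in> topspace (locally_uniform_topology S X)" using g by simp
    fix U assume "openin (locally_uniform_topology S X) U \<and> g \<in> U"
    then obtain K e where K: "compact K" "K \<subseteq> S" "e > 0"
        "\<forall>h\<in>X. (\<forall>x\<in>K. dist (h x) (g x) < e) \<longrightarrow> h \<in> U"
      unfolding openin_locally_uniform_topology by metis
    then have "\<forall>\<^sub>F n in F. \<forall>x\<in>K. dist (f n x) (g x) < e"
      using * uniform_limitD by blast
    with X show "\<forall>\<^sub>F n in F. f n \<in> U"
      by eventually_elim (use K in blast)
  qed
qed

lemma limitin_locally_uniform_topology:
  fixes S :: "'a::euclidean_space set"
  assumes S: "open S" and X: "eventually (\<lambda>n. f n \<in> X) F" and g: "g \<in> X"
  shows "limitin (locally_uniform_topology S X) f g F \<longleftrightarrow>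
           (\<forall>x\<in>S. \<exists>V. open V \<and> x \<in> V \<and> V \<subseteq> S \<and> uniform_limit V f g F)"
  unfolding limitin_locally_uniform_topology_compact[OF X g]
proof
  assume *: "\<forall>K. compact K \<and> K \<subseteq> S \<longrightarrow> uniform_limit K f g F"
  show "\<forall>x\<in>S. \<exists>V. open V \<and> x \<in> V \<and> V \<subseteq> S \<and> uniform_limit V f g F"
  proof
    fix x assume "x \<in> S"
    then obtain e where e: "e > 0" "cball x e \<subseteq> S"
      using S open_contains_cball by blast
    then have "uniform_limit (cball x e) f g F" using * by simp
    then have "uniform_limit (ball x e) f g F"
      by (rule uniform_limit_on_subset) auto
    then show "\<exists>V. open V \<and> x \<in> V \<and> V \<subseteq> S \<and> uniform_limit V f g F"
      using e by (intro exI[of _ "ball x e"]) (auto simp: subset_iff)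
  qed
next
  assume *: "\<forall>x\<in>S. \<exists>V. open V \<and> x \<in> V \<and> V \<subseteq> S \<and> uniform_limit V f g F"
  show "\<forall>K. compact K \<and> K \<subseteq> S \<longrightarrow> uniform_limit K f g F"
  proof (intro allI impI uniform_limitI)
    fix K and e :: real assume K: "compact K \<and> K \<subseteq> S" and e: "e > 0"
    obtain V where V: "\<And>x. x \<in> K \<Longrightarrow> open (V x) \<and> x \<in> V x \<and> uniform_limit (V x) f g F"
      using * K by (metis subsetD)
    obtain C where C: "C \<subseteq> K" "finite C" "K \<subseteq> (\<Union>c\<in>C. V c)"
      by (rule compactE_image[of K K V]) (use K V in auto)
    have "\<forall>\<^sub>F n in F. \<forall>x\<in>V c. dist (f n x) (g x) < e" if "c \<in> C" for c
      using uniform_limitD[OF _ e] V C(1) that by blast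
    then have "\<forall>\<^sub>F n in F. \<forall>c\<in>C. \<forall>x\<in>V c. dist (f n x) (g x) < e"
      by (simp add: eventually_ball_finite_distrib[OF C(2)])
    then show "\<forall>\<^sub>F n in F. \<forall>x\<in>K. dist (f n x) (g x) < e"
      by (rule eventually_mono) (use C in blast)
  qed
qed

end

theory Submission
  imports Defs "HOL-Complex_Analysis.Complex_Analysis"
begin

text \<open>
  The \<open>n\<close>-th Fourier coefficient of an eigenfunction \<open>f\<close> on the circle of radius \<open>r\<close>, together with the
  \<open>(n + 1)\<close>-th one of \<open>\<partial>f/\<partial>cnj z\<close>, solves a linear first order system in \<open>r\<close> whose bounded solutions
  near \<open>0\<close> form a line. This line is spanned by the coefficients of an explicit eigenfunction, which is the
  restriction to \<open>w = cnj z\<close> of \<open>z^n G_n(zw)\<close> (of \<open>w^{-n} G_{-n}(zw)\<close> for \<open>n < 0\<close>), where \<open>G_n\<close> is the power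
  series solution of \<open>4 (1 - t)\<^sup>2 (t G'' + (n + 1) G') = l G\<close> with \<open>G_n(0) = 1\<close>. Hence \<open>f\<close> has an expansion
  with certain coefficients \<open>c n\<close>, and the same series in \<open>(z, w)\<close> is \<open>F\<close>. Since \<open>G_n\<close> tends to \<open>1\<close> locally
  uniformly on the disc as \<open>n\<close> grows, \<open>c n\<close> is at most a constant times \<open>R^{-n} sup {|f z| : |z| \<le> R}\<close> for every
  \<open>R < 1\<close>; this gives the convergence of the series on the whole bidisc and the continuity of \<open>f \<mapsto> F\<close>.
  \<open>F\<close> is unique because all its derivatives at \<open>(0, 0)\<close> are Wirtinger derivatives of \<open>f\<close>.
\<close>

section \<open>Fourier coefficients on circles\<close>

text \<open>\<open>G_n(r^2)\<close> can vanish for some \<open>n\<close> at a given radius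
  \<open>r\<close> (then \<open>l\<close> is a Dirichlet eigenvalue of the disc of radius
  \<open>r\<close>), so the coefficients \<open>c n\<close> cannot all be read off at one prescribed
  radius. As \<open>G_n\<close> tends to 1, only finitely many \<open>n\<close> are at risk at
  radius \<open>R\<close>; these are read off at a smaller radius where every \<open>G_n\<close>
  lies within 1/2 of 1, at the cost of a fixed factor. \<open>G_n\<close> tends to 1 because its
  recursion divides by \<open>(k + 1) (k + 1 + n)\<close>: forgetting the second factor leaves a
  majorant independent of \<open>n\<close>, and keeping it in the last step alone gains
  \<open>1 / (n + 1)\<close>. The constants depend on \<open>l\<close> and \<open>R\<close> but not
  on \<open>f\<close>, so one estimate serves both convergence and continuity. Convergence of the
  Fourier series of \<open>f\<close> is not presupposed: the series \<open>F\<close> is summed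
  first, and its restriction is identified with \<open>f\<close> because both have the same Fourier
  coefficients on every circle.\<close>

definition fourier :: "(complex \<Rightarrow> complex) \<Rightarrow> int \<Rightarrow> real \<Rightarrow> complex" where
  "fourier f n r = integral {0..2*pi} (\<lambda>t. f (rcis r t) * cis (- of_int n * t))"

lemma continuous_on_circle:
  assumes "continuous_on S f" "\<And>t. t \<in> T \<Longrightarrow> rcis r t \<in> S"
  shows "continuous_on T (\<lambda>t. f (rcis r t))"
  by (rule continuous_on_compose2[OF assms(1)])
     (use assms(2) in \<open>auto simp: rcis_def intro!: continuous_intros\<close>)

lemma fourier_integrable:
  assumes "continuous_on (sphere 0 r) f" "r \<ge> 0"
  shows "(\<lambda>t. f (rcis r t) * cis (c * t)) integrable_on {0..2*pi}"
  by (intro integrable_continuous_real continuous_intros continuous_on_circle[OF assms(1)])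
     (use assms(2) in auto)

lemma norm_fourier_le:
  assumes "continuous_on (sphere 0 r) f" "r \<ge> 0" "\<And>z. cmod z = r \<Longrightarrow> cmod (f z) \<le> B"
  shows "cmod (fourier f n r) \<le> 2 * pi * B"
proof -
  have "cmod (fourier f n r) \<le> B * (2 * pi - 0)"
    unfolding fourier_def
    by (rule integral_bound)
       (use assms in \<open>auto intro!: continuous_intros continuous_on_circle[OF assms(1)] simp: norm_mult\<close>)
  then show ?thesis by (simp add: mult.commute)
qed

lemma fourier_add:
  assumes "continuous_on (sphere 0 r) f" "continuous_on (sphere 0 r) g" "r \<ge> 0"
  shows "fourier (\<lambda>z. f z + g z) n r = fourier f n r + fourier g n r"
  unfolding fourier_def distrib_right
  by (intro integral_add fourier_integrable assms)

lemma fourier_cmult: "fourier (\<lambda>z. c * f z) n r = c * fourier f n r"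
  unfolding fourier_def by (simp add: mult.assoc)

lemma fourier_cong:
  assumes "\<And>z. cmod z = r \<Longrightarrow> f z = g z" "r \<ge> 0"
  shows "fourier f n r = fourier g n r"
  unfolding fourier_def by (rule integral_cong) (use assms in auto)

lemma fourier_mult_id: "fourier (\<lambda>z. f z * z) n r = of_real r * fourier f (n - 1) r"
proof -
  have "f (rcis r t) * rcis r t * cis (- of_int n * t) =
        of_real r * (f (rcis r t) * cis (- of_int (n - 1) * t))" for t
    by (simp add: rcis_def cis_mult mult_ac algebra_simps)
  then show ?thesis by (simp only: fourier_def integral_mult_right)
qed

lemma fourier_mult_cnj: "fourier (\<lambda>z. f z * cnj z) n r = of_real r * fourier f (n + 1) r"
proof -
  have "f (rcis r t) * cnj (rcis r t) * cis (- of_int n * t) =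
        of_real r * (f (rcis r t) * cis (- of_int (n + 1) * t))" for t
    by (simp add: rcis_def cis_mult cis_cnj mult_ac algebra_simps)
  then show ?thesis by (simp only: fourier_def integral_mult_right)
qed

text \<open>On a circle, multiplication by \<open>z\<close> or \<open>cnj z\<close> shifts the index
  by one and scales by \<open>r\<close>, so vanishing of all coefficients survives multiplication by
  the real coordinates. The induction generalises over \<open>h\<close> because the product case
  applies the hypothesis for \<open>q\<close> to \<open>h\<close> times \<open>p\<close>.\<close>

lemma fourier_mult_real_polynomial:
  assumes "real_polynomial_function p" "r \<ge> 0"
    and "continuous_on (sphere 0 r) h" "\<And>n. fourier h n r = 0"
  shows "fourier (\<lambda>z. h z * of_real (p z)) n r = 0"
  using assms(1,3,4)
proof (induction arbitrary: h n)
  case (linear p h n)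
  interpret p: bounded_linear p by fact
  \<comment> \<open>A real-linear functional on the plane has the form
    \<open>\<alpha> z + cnj (\<alpha> z)\<close>, and \<open>\<alpha>\<close> is its Wirtinger
    coefficient.\<close>
  define \<alpha> where "\<alpha> = (of_real (p 1) - \<i> * of_real (p \<i>)) / 2"
  have p: "of_real (p z) = \<alpha> * z + cnj \<alpha> * cnj z" for z
  proof -
    have "p z = p (Re z *\<^sub>R 1 + Im z *\<^sub>R \<i>)" by (rule arg_cong[of _ _ p]) (simp add: complex_eq_iff)
    also have "\<dots> = Re z * p 1 + Im z * p \<i>" by (simp only: p.add p.scaleR real_scaleR_def)
    finally show ?thesis by (simp add: \<alpha>_def complex_eq_iff field_simps)
  qed
  have "fourier (\<lambda>z. h z * of_real (p z)) n r =
        fourier (\<lambda>z. \<alpha> * (h z * z) + cnj \<alpha> * (h z * cnj z)) n r"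
    by (simp add: p algebra_simps)
  also have "\<dots> = 0"
    by (subst fourier_add)
       (auto simp: fourier_cmult fourier_mult_id fourier_mult_cnj linear assms(2)
             intro!: continuous_intros linear)
  finally show ?case .
next
  case (const c h n)
  then show ?case using fourier_cmult[of "of_real c" h n r] by (simp add: mult.commute)
next
  case (add p q h n)
  have "continuous_on (sphere 0 r) (\<lambda>z. complex_of_real (p z))"
    "continuous_on (sphere 0 r) (\<lambda>z. complex_of_real (q z))"
    using add.hyps by (auto intro!: continuous_intros continuous_on_polymonial_function
        simp: real_polynomial_function_eq)
  then show ?case
    using add by (simp add: distrib_left fourier_add continuous_on_mult assms(2))
next
  case (mult p q h n)
  have "continuous_on (sphere 0 r) (\<lambda>z. complex_of_real (p z))"
    using mult.hyps by (auto intro!: continuous_intros continuous_on_polymonial_function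
        simp: real_polynomial_function_eq)
  then have "fourier (\<lambda>z. (h z * of_real (p z)) * of_real (q z)) n r = 0"
    using mult by (intro mult.IH) (auto intro!: continuous_intros)
  then show ?case by (simp add: mult.assoc)
qed

text \<open>All products of \<open>h\<close> with polynomials in the real coordinates have mean zero; by Stone-Weierstrass so has \<open>h * cnj h\<close>.\<close>

lemma fourier_eq_0_imp_eq_0:
  assumes h: "continuous_on (sphere 0 r) h" and r: "r \<ge> 0"
    and 0: "\<And>n. fourier h n r = 0" and z: "cmod z = r"
  shows "h z = 0"
proof -
  obtain B where B: "B > 0" "\<And>z. cmod z = r \<Longrightarrow> cmod (h z) \<le> B"
    using compact_imp_bounded[OF compact_continuous_image[OF h]] unfolding bounded_pos by auto
  define J where "J = integral {0..2*pi} (\<lambda>t. (cmod (h (rcis r t)))\<^sup>2)"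
  have cont: "continuous_on {0..2*pi} (\<lambda>t. (cmod (h (rcis r t)))\<^sup>2)"
    by (intro continuous_intros continuous_on_circle[OF h]) (use r in auto)
  have "\<bar>J\<bar> \<le> 0"
  proof (rule field_le_epsilon)
    fix e :: real assume e: "e > 0"
    \<comment> \<open>Makes the final error \<open>2 * pi * (B * (2 * d))\<close> equal to
      \<open>e\<close>.\<close>
    define d where "d = e / (4 * pi * B)"
    have d: "d > 0" using e B by (simp add: d_def)
    obtain p where p: "real_polynomial_function p" "\<And>x. x \<in> sphere 0 r \<Longrightarrow> \<bar>Re (h x) - p x\<bar> < d"
      by (rule Stone_Weierstrass_real_polynomial_function[of "sphere 0 r" "\<lambda>z. Re (h z)" d])
        (use d in \<open>auto intro!: continuous_intros h\<close>)
    obtain q where q: "real_polynomial_function q" "\<And>x. x \<in> sphere 0 r \<Longrightarrow> \<bar>Im (h x) - q x\<bar> < d"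
      by (rule Stone_Weierstrass_real_polynomial_function[of "sphere 0 r" "\<lambda>z. Im (h z)" d])
        (use d in \<open>auto intro!: continuous_intros h\<close>)
    \<comment> \<open>\<open>p - \<i> q\<close> approximates \<open>cnj h\<close>, so
      \<open>k\<close> approximates \<open>h * cnj h\<close>, while its mean over the circle is
      0.\<close>
    define k where "k z = h z * of_real (p z) + (- \<i>) * (h z * of_real (q z))" for z
    have cp: "continuous_on (sphere 0 r) (\<lambda>z. complex_of_real (p z))"
      "continuous_on (sphere 0 r) (\<lambda>z. complex_of_real (q z))"
      using p q by (auto intro!: continuous_intros continuous_on_polymonial_function
          simp: real_polynomial_function_eq)
    have ck: "continuous_on (sphere 0 r) k"
      unfolding k_def by (intro continuous_intros h cp)
    have k0: "fourier k 0 r = 0"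
      unfolding k_def
      by (subst fourier_add)
         (auto intro!: continuous_intros h cp r simp: fourier_cmult[of "\<i>"]
            fourier_mult_real_polynomial[OF p(1) r h 0] fourier_mult_real_polynomial[OF q(1) r h 0]
            fourier_cmult[of "- 1", simplified])
    have bd: "cmod (h z * cnj (h z) - k z) \<le> B * (2 * d)" if "cmod z = r" for z
    proof -
      have "h z * cnj (h z) - k z = h z * Complex (Re (h z) - p z) (- (Im (h z) - q z))"
        by (simp add: k_def complex_eq_iff algebra_simps)
      moreover have "cmod (Complex (Re (h z) - p z) (- (Im (h z) - q z))) \<le> d + d"
        using p(2)[of z] q(2)[of z] that
        by (intro order_trans[OF cmod_le] add_mono) (auto)
      ultimately show ?thesis
        using B that by (auto simp: norm_mult intro!: mult_mono)
    qed
    have "fourier (\<lambda>z. h z * cnj (h z) - k z) 0 r = fourier (\<lambda>z. h z * cnj (h z)) 0 r - fourier k 0 r"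
      using fourier_add[of r "\<lambda>z. h z * cnj (h z)" "\<lambda>z. (-1) * k z" 0] ck h r
        fourier_cmult[of "-1" k 0 r]
      by (simp add: continuous_intros)
    moreover have "fourier (\<lambda>z. h z * cnj (h z)) 0 r = of_real J"
      unfolding fourier_def J_def of_int_0 minus_zero mult_zero_left cis_zero mult_1_right
        complex_norm_square[symmetric]
      using integral_linear[OF integrable_continuous_real[OF cont] bounded_linear_of_real[where 'a=complex]]
      by (simp add: o_def)
    moreover have "cmod (fourier (\<lambda>z. h z * cnj (h z) - k z) 0 r) \<le> 2 * pi * (B * (2 * d))"
      by (rule norm_fourier_le) (use bd r in \<open>auto intro!: continuous_intros h ck\<close>)
    ultimately show "\<bar>J\<bar> \<le> 0 + e" using k0 B by (simp add: d_def)
  qed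
  then have "J = 0" by simp
  then have *: "h (rcis r t) = 0" if "t \<in> {0..2*pi}" for t
    using that integral_eq_0_iff[OF cont] by (simp add: J_def)
  have "z = rcis r (Arg2pi z)"
    using Arg2pi_eq[of z] z by (simp add: rcis_def cis_conv_exp)
  with *[of "Arg2pi z"] Arg2pi[of z] show ?thesis by auto
qed

section \<open>Wirtinger derivatives and the differentiation of Fourier coefficients\<close>

definition has_wirtinger :: "(complex \<Rightarrow> complex) \<Rightarrow> complex \<Rightarrow> complex \<Rightarrow> complex \<Rightarrow> bool" where
  "has_wirtinger f p q z \<longleftrightarrow> (f has_derivative (\<lambda>h. p * h + q * cnj h)) (at z)"

lemma has_wirtinger_imp_continuous_on:
  "(\<And>z. z \<in> S \<Longrightarrow> has_wirtinger f (P z) (Q z) z) \<Longrightarrow> continuous_on S f"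
  unfolding has_wirtinger_def
  by (meson continuous_at_imp_continuous_on has_derivative_continuous)

lemma has_wirtinger_vector_derivative:
  assumes "has_wirtinger f p q (g t)" "(g has_vector_derivative g') (at t)"
  shows "((\<lambda>t. f (g t)) has_vector_derivative p * g' + q * cnj g') (at t)"
proof -
  have "((\<lambda>t. f (g t)) has_derivative (\<lambda>h. p * (h *\<^sub>R g') + q * cnj (h *\<^sub>R g'))) (at t)"
    using has_derivative_compose[OF assms(2)[unfolded has_vector_derivative_def]
        assms(1)[unfolded has_wirtinger_def]] .
  then show ?thesis
    by (simp add: has_vector_derivative_def scaleR_conv_of_real algebra_simps)
qed

lemma has_vector_derivative_cis:
  "((\<lambda>t. cis (c * t)) has_vector_derivative \<i> * of_real c * cis (c * t)) (at t within S)"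
  by (auto intro!: derivative_eq_intros simp: has_vector_derivative_def scaleR_conv_of_real)

text \<open>In polar coordinates the radial derivative of \<open>f\<close> is
  \<open>P cis t + Q cis (- t)\<close> and the angular one is
  \<open>\<i> r (P cis t - Q cis (- t))\<close>; the factors \<open>cis t\<close> and
  \<open>cis (- t)\<close> shift the index. The first claim is differentiation under the integral
  sign, the second is integration by parts over a full period.\<close>

lemma fourier_has_vector_derivative:
  assumes f: "\<And>z. z \<in> disc \<Longrightarrow> has_wirtinger f (P z) (Q z) z"
    and P: "continuous_on disc P" and Q: "continuous_on disc Q" and r: "0 < r" "r < 1"
  shows "(fourier f n has_vector_derivative (fourier P (n - 1) r + fourier Q (n + 1) r)) (at r)"
    and "of_int n * fourier f n r = of_real r * (fourier P (n - 1) r - fourier Q (n + 1) r)"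
proof -
  have cf: "continuous_on disc f" by (rule has_wirtinger_imp_continuous_on) (rule f)
  have sub: "sphere 0 x \<subseteq> disc" if "x < 1" for x using that by auto
  define D where "D x t = P (rcis x t) * cis (- of_int (n - 1) * t) + Q (rcis x t) * cis (- of_int (n + 1) * t)" for x t
  have shift: "cis (- of_int (n - 1) * t) = cis t * cis (- of_int n * t)"
      "cis (- of_int (n + 1) * t) = cnj (cis t) * cis (- of_int n * t)" for t
    by (simp_all add: cis_mult cis_cnj algebra_simps)
  have D: "D x t = (P (rcis x t) * cis t + Q (rcis x t) * cnj (cis t)) * cis (- of_int n * t)" for x t
    by (simp only: D_def distrib_right mult.assoc shift)
  have "((\<lambda>r. integral (cbox 0 (2*pi)) (\<lambda>t. f (rcis r t) * cis (- of_int n * t)))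
     has_vector_derivative integral (cbox 0 (2*pi)) (D r)) (at r within {0<..<1})"
  proof (rule leibniz_rule_vector_derivative)
    fix x t :: real assume x: "x \<in> {0<..<1}"
    have "((\<lambda>x. rcis x t) has_vector_derivative cis t) (at x)"
      unfolding rcis_def by (auto intro!: derivative_eq_intros simp: scaleR_conv_of_real has_vector_derivative_def)
    from has_wirtinger_vector_derivative[OF _ this, of f "P (rcis x t)" "Q (rcis x t)"] x
    have "((\<lambda>x. f (rcis x t)) has_vector_derivative (P (rcis x t) * cis t + Q (rcis x t) * cnj (cis t))) (at x)"
      using f[of "rcis x t"] by auto
    from has_vector_derivative_mult_left[OF this]
    show "((\<lambda>x. f (rcis x t) * cis (- of_int n * t)) has_vector_derivative D x t) (at x within {0<..<1})"
      unfolding D by (rule has_vector_derivative_at_within)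
  next
    fix x :: real assume "x \<in> {0<..<1}"
    then show "(\<lambda>t. f (rcis x t) * cis (- of_int n * t)) integrable_on cbox 0 (2*pi)"
      using fourier_integrable[OF continuous_on_subset[OF cf sub], of x "- of_int n"] by auto
  next
    have "continuous_on ({0<..<1} \<times> cbox 0 (2*pi)) (\<lambda>p. g (rcis (fst p) (snd p)))"
      if "continuous_on disc g" for g :: "complex \<Rightarrow> complex"
      by (rule continuous_on_compose2[OF that]) (auto simp: rcis_def norm_mult intro!: continuous_intros)
    from this[OF P] this[OF Q]
    show "continuous_on ({0<..<1} \<times> cbox 0 (2*pi)) (\<lambda>(x, t). D x t)"
      unfolding D_def case_prod_unfold by (intro continuous_intros)
  qed (use r in auto)
  moreover have "integral {0..2*pi} (D r) = fourier P (n - 1) r + fourier Q (n + 1) r"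
    unfolding D_def fourier_def
    by (intro integral_add fourier_integrable continuous_on_subset[OF P sub] continuous_on_subset[OF Q sub])
       (use r in auto)
  ultimately show "(fourier f n has_vector_derivative (fourier P (n - 1) r + fourier Q (n + 1) r)) (at r)"
    using r by (simp add: fourier_def[abs_def] has_vector_derivative_within_open[of r "{0<..<1}"])
  \<comment> \<open>\<open>E\<close> is the \<open>t\<close>-derivative of the integrand of
    \<open>fourier f n r\<close>, so its integral over a period vanishes; expanding that integral
    gives the second claim.\<close>
  define E where "E t = \<i> * of_real r * (P (rcis r t) * cis (- of_int (n - 1) * t))
     + (- \<i> * of_real r * (Q (rcis r t) * cis (- of_int (n + 1) * t))
     + (- \<i> * of_int n) * (f (rcis r t) * cis (- of_int n * t)))" for t
  have der: "((\<lambda>t. f (rcis r t) * cis (- of_int n * t)) has_vector_derivative E t) (at t within {0..2*pi})" for t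
  proof -
    have "((\<lambda>t. rcis r t) has_vector_derivative of_real r * (\<i> * cis t)) (at t)"
      unfolding rcis_def using has_vector_derivative_cis[of 1] by (auto intro!: derivative_eq_intros)
    from has_wirtinger_vector_derivative[OF _ this, of f "P (rcis r t)" "Q (rcis r t)"]
    have "((\<lambda>t. f (rcis r t)) has_vector_derivative
        (P (rcis r t) * (of_real r * (\<i> * cis t)) + Q (rcis r t) * cnj (of_real r * (\<i> * cis t)))) (at t)"
      using f[of "rcis r t"] r by auto
    from has_vector_derivative_mult[OF this has_vector_derivative_cis[of "- of_int n" t UNIV]]
    have "((\<lambda>t. f (rcis r t) * cis (- of_int n * t)) has_vector_derivative E t) (at t)"
      by (rule has_vector_derivative_eq_rhs) (simp only: E_def shift, simp add: ring_distribs mult_ac)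
    then show ?thesis by (rule has_vector_derivative_at_within)
  qed
  have ints: "(\<lambda>t. g (rcis r t) * cis (c * t)) integrable_on {0..2*pi}" if "continuous_on disc g" for g c
    by (rule fourier_integrable[OF continuous_on_subset[OF that sub]]) (use r in auto)
  have "(E has_integral f (rcis r (2*pi)) * cis (- of_int n * (2*pi)) - f (rcis r 0) * cis (- of_int n * 0)) {0..2*pi}"
    by (rule fundamental_theorem_of_calculus) (use der in auto)
  moreover have "cis (- of_int n * (2*pi)) = 1"
    using cis_multiple_2pi[of "- of_int n"] by (simp add: mult_ac)
  ultimately have "integral {0..2*pi} E = 0"
    by (simp add: rcis_def integral_unique)
  moreover have "integral {0..2*pi} E = \<i> * of_real r * fourier P (n - 1) r
      + (- \<i> * of_real r * fourier Q (n + 1) r + (- \<i> * of_int n) * fourier f n r)"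
    unfolding E_def fourier_def integral_mult_right[symmetric]
    by (simp only: integral_add integrable_add integrable_on_mult_right ints[OF P] ints[OF Q] ints[OF cf])
  ultimately have "\<i> * (of_real r * (fourier P (n - 1) r - fourier Q (n + 1) r)) = \<i> * (of_int n * fourier f n r)"
    by (simp add: algebra_simps)
  then show "of_int n * fourier f n r = of_real r * (fourier P (n - 1) r - fourier Q (n + 1) r)"
    by simp
qed

section \<open>The radial system\<close>

text \<open>Satisfied by the \<open>n\<close>-th Fourier coefficient \<open>a\<close> of an eigenfunction \<open>f\<close> and the \<open>(n + 1)\<close>-th one \<open>b\<close> of
  \<open>\<partial>f/\<partial>cnj z\<close>. Only this order of the Wirtinger derivatives occurs, so that the symmetry of second
  derivatives is not needed.\<close>

definition radial_system :: "complex \<Rightarrow> int \<Rightarrow> (real \<Rightarrow> complex) \<Rightarrow> (real \<Rightarrow> complex) \<Rightarrow> bool" where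
  "radial_system l n a b \<longleftrightarrow> (\<forall>r\<in>{0<..<1}.
     (a has_vector_derivative (of_int n / of_real r * a r + 2 * b r)) (at r) \<and>
     (b has_vector_derivative (l / (2 * (1 - of_real (r\<^sup>2))\<^sup>2) * a r - of_int (n + 1) / of_real r * b r)) (at r))"

lemma radial_system_combination:
  assumes "radial_system l n a b" "radial_system l n a' b'"
  shows "radial_system l n (\<lambda>r. a r - c * a' r) (\<lambda>r. b r - c * b' r)"
  unfolding radial_system_def
proof (intro ballI conjI)
  fix r :: real assume r: "r \<in> {0<..<1}"
  note 1 = assms[unfolded radial_system_def, rule_format, OF r]
  show "((\<lambda>r. a r - c * a' r) has_vector_derivative
      (of_int n / of_real r * (a r - c * a' r) + 2 * (b r - c * b' r))) (at r)"
    by (rule has_vector_derivative_eq_rhs[OF has_vector_derivative_diff[OF conjunct1[OF 1(1)]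
          has_vector_derivative_mult_right[OF conjunct1[OF 1(2)]]]]) (simp add: algebra_simps)
  show "((\<lambda>r. b r - c * b' r) has_vector_derivative
      (l / (2 * (1 - of_real (r\<^sup>2))\<^sup>2) * (a r - c * a' r) - of_int (n + 1) / of_real r * (b r - c * b' r))) (at r)"
    by (rule has_vector_derivative_eq_rhs[OF has_vector_derivative_diff[OF conjunct2[OF 1(1)]
          has_vector_derivative_mult_right[OF conjunct2[OF 1(2)]]]]) (simp add: algebra_simps diff_divide_distrib add_divide_distrib)
qed

text \<open>Gronwall in both directions: \<open>E x * exp (- C * x)\<close> is nonincreasing and
  \<open>E x * exp (C * x)\<close> is nondecreasing, so a zero of the nonnegative \<open>E\<close>
  propagates to the right by the former and to the left by the latter.\<close>

lemma gronwall_zero: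
  fixes E E' :: "real \<Rightarrow> real"
  assumes der: "\<And>x. x \<in> {s..t} \<Longrightarrow> (E has_real_derivative E' x) (at x)"
    and le: "\<And>x. x \<in> {s..t} \<Longrightarrow> \<bar>E' x\<bar> \<le> C * E x"
    and nn: "\<And>x. E x \<ge> 0" and \<rho>: "\<rho> \<in> {s..t}" "E \<rho> = 0" and x: "x \<in> {s..t}"
  shows "E x = 0"
proof (cases "\<rho> \<le> x")
  case True
  have "E x * exp (- C * x) \<le> E \<rho> * exp (- C * \<rho>)"
  proof (rule DERIV_nonpos_imp_nonincreasing[OF True])
    fix y assume y: "\<rho> \<le> y" "y \<le> x"
    then have y': "y \<in> {s..t}" using \<rho> x by auto
    have "((\<lambda>x. E x * exp (- C * x)) has_real_derivative (E' y - C * E y) * exp (- C * y)) (at y)"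
      by (auto intro!: derivative_eq_intros der y' simp: algebra_simps)
    moreover have "(E' y - C * E y) * exp (- C * y) \<le> 0"
      using le[OF y'] by (intro mult_nonpos_nonneg) auto
    ultimately show "\<exists>z. ((\<lambda>x. E x * exp (- C * x)) has_real_derivative z) (at y) \<and> z \<le> 0" by blast
  qed
  then show ?thesis using \<rho> nn[of x] by (simp add: mult_le_0_iff)
next
  case False
  then have "x \<le> \<rho>" by simp
  then have "E x * exp (C * x) \<le> E \<rho> * exp (C * \<rho>)"
  proof (rule DERIV_nonneg_imp_nondecreasing)
    fix y assume y: "x \<le> y" "y \<le> \<rho>"
    then have y': "y \<in> {s..t}" using \<rho> x by auto
    have "((\<lambda>x. E x * exp (C * x)) has_real_derivative (E' y + C * E y) * exp (C * y)) (at y)"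
      by (auto intro!: derivative_eq_intros der y' simp: algebra_simps)
    moreover have "(E' y + C * E y) * exp (C * y) \<ge> 0"
      using le[OF y'] by (intro mult_nonneg_nonneg) auto
    ultimately show "\<exists>z. ((\<lambda>x. E x * exp (C * x)) has_real_derivative z) (at y) \<and> 0 \<le> z" by blast
  qed
  then show ?thesis using \<rho> nn[of x] by (simp add: mult_le_0_iff)
qed

text \<open>Between \<open>\<rho>\<close> and \<open>r\<close> the coefficients of the system stay
  bounded, since this compact interval avoids both singular points 0 and 1. Hence the squared norm
  of \<open>(a, b)\<close> satisfies a Gronwall inequality there.\<close>

lemma radial_system_unique:
  assumes sys: "radial_system l n a b" and \<rho>: "0 < \<rho>" "\<rho> < 1" "a \<rho> = 0" "b \<rho> = 0"
    and r: "0 < r" "r < 1"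
  shows "a r = 0"
proof -
  define s t where "s = min \<rho> r" and "t = max \<rho> r"
  have st: "0 < s" "t < 1" "s \<le> t" using \<rho> r by (auto simp: s_def t_def)
  define N where "N = \<bar>real_of_int n\<bar> + 1"
  define q where "q = cmod l / (2 * (1 - t\<^sup>2)\<^sup>2)"
  \<comment> \<open>A common bound on \<open>{s..t}\<close> for all four coefficients of the system;
    \<open>N\<close> covers both \<open>n\<close> and \<open>n + 1\<close>.\<close>
  define C where "C = N / s + 2 + q"
  have t1: "t\<^sup>2 < 1" using st \<rho> r by (intro power_less_one_iff[THEN iffD2]) (auto simp: t_def)
  have q: "q \<ge> 0" by (simp add: q_def)
  have N: "N \<ge> 1" by (simp add: N_def)
  have C: "C \<ge> 0" "N / s \<le> C" "2 \<le> C" "q \<le> C" using st q N by (auto simp: C_def)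
  define a' where "a' x = of_int n / of_real x * a x + 2 * b x" for x
  define b' where "b' x = l / (2 * (1 - of_real (x\<^sup>2))\<^sup>2) * a x - of_int (n + 1) / of_real x * b x" for x
  define E where "E x = (a x \<bullet> a x + b x \<bullet> b x)" for x
  define E' where "E' x = 2 * (a x \<bullet> a' x + b x \<bullet> b' x)" for x
  have bounds: "cmod (a' x) \<le> C * (cmod (a x) + cmod (b x))" "cmod (b' x) \<le> C * (cmod (a x) + cmod (b x))"
    if x: "x \<in> {s..t}" for x
  proof -
    have x0: "x > 0" "x < 1" using x st by auto
    have 1: "cmod (of_int n / of_real x) \<le> C"
    proof -
      have "cmod (of_int n / of_real x) = \<bar>real_of_int n\<bar> / x" using x0 by (simp add: norm_divide)
      also have "\<dots> \<le> N / s" using x st x0 by (intro frac_le) (auto simp: N_def)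
      finally show ?thesis using C by linarith
    qed
    have 2: "cmod (of_int (n + 1) / of_real x) \<le> C"
    proof -
      have "cmod (of_int (n + 1) / of_real x) = \<bar>real_of_int (n + 1)\<bar> / x"
        using x0 by (simp only: norm_divide norm_of_int norm_of_real abs_of_pos)
      also have "\<dots> \<le> N / s" using x st x0 by (intro frac_le) (auto simp: N_def)
      finally show ?thesis using C by linarith
    qed
    have 3: "cmod (l / (2 * (1 - of_real (x\<^sup>2))\<^sup>2)) \<le> C"
    proof -
      have x2: "x\<^sup>2 \<le> t\<^sup>2" using x x0 by (intro power_mono) auto
      have "1 - complex_of_real (x\<^sup>2) = of_real (1 - x\<^sup>2)" by simp
      then have "cmod (l / (2 * (1 - of_real (x\<^sup>2))\<^sup>2)) = cmod l / (2 * (1 - x\<^sup>2)\<^sup>2)"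
        by (simp only: norm_divide norm_mult norm_power norm_of_real power2_abs) simp
      also have "\<dots> \<le> q" unfolding q_def using x2 t1
        by (intro divide_left_mono mult_left_mono power_mono mult_pos_pos) auto
      finally show ?thesis using C by linarith
    qed
    show "cmod (a' x) \<le> C * (cmod (a x) + cmod (b x))"
      unfolding a'_def distrib_left using 1 C(1,3)
      by (intro order_trans[OF norm_triangle_ineq] add_mono) (auto simp only: norm_mult norm_numeral intro!: mult_right_mono norm_ge_zero)
    show "cmod (b' x) \<le> C * (cmod (a x) + cmod (b x))"
      unfolding b'_def distrib_left using 2 3
      by (intro order_trans[OF norm_triangle_ineq4] add_mono) (auto simp only: norm_mult intro!: mult_right_mono norm_ge_zero)
  qed
  \<comment> \<open>In \<open>4 * C\<close> one factor 2 comes from differentiating the squared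
    norms, the other from \<open>(x + y)^2 \<le> 2 (x^2 + y^2)\<close>.\<close>
  have "E r = 0"
  proof (rule gronwall_zero[of s t E E' "4 * C" \<rho> r])
    fix x assume x: "x \<in> {s..t}"
    then have "x \<in> {0<..<1}" using st by auto
    from sys[unfolded radial_system_def, rule_format, OF this]
    have "(a has_vector_derivative a' x) (at x)" "(b has_vector_derivative b' x) (at x)"
      by (auto simp: a'_def b'_def)
    then have "(E has_derivative (\<lambda>h. (a x \<bullet> (h *\<^sub>R a' x) + (h *\<^sub>R a' x) \<bullet> a x) + (b x \<bullet> (h *\<^sub>R b' x) + (h *\<^sub>R b' x) \<bullet> b x))) (at x)"
      unfolding E_def[abs_def] has_vector_derivative_def
      by (intro has_derivative_add has_derivative_inner)
    then show "(E has_real_derivative E' x) (at x)"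
      unfolding has_field_derivative_def
      by (rule has_derivative_eq_rhs) (auto simp: fun_eq_iff E'_def inner_commute algebra_simps)
    have "\<bar>a x \<bullet> a' x + b x \<bullet> b' x\<bar> \<le> cmod (a x) * cmod (a' x) + cmod (b x) * cmod (b' x)"
      by (intro order_trans[OF abs_triangle_ineq] add_mono Cauchy_Schwarz_ineq2)
    also have "\<dots> \<le> cmod (a x) * (C * (cmod (a x) + cmod (b x))) + cmod (b x) * (C * (cmod (a x) + cmod (b x)))"
      using bounds[OF x] by (intro add_mono mult_left_mono) auto
    also have "\<dots> = C * (cmod (a x) + cmod (b x))\<^sup>2" by (simp add: power2_eq_square algebra_simps)
    also have "\<dots> \<le> C * (2 * E x)"
    proof (intro mult_left_mono C)
      have "0 \<le> (cmod (a x) - cmod (b x))\<^sup>2" by simp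
      then show "(cmod (a x) + cmod (b x))\<^sup>2 \<le> 2 * E x"
        by (simp add: E_def power2_norm_eq_inner[symmetric] power2_eq_square algebra_simps)
    qed
    finally show "\<bar>E' x\<bar> \<le> 4 * C * E x" by (simp add: E'_def abs_mult)
  qed (auto simp: E_def s_def t_def \<rho>)
  then have "a r \<bullet> a r = 0" unfolding E_def by (smt (verit) inner_ge_zero)
  then show ?thesis by simp
qed

text \<open>The Wronskian multiplied by \<open>r\<close> is constant, and it tends to \<open>0\<close> with \<open>r\<close>.\<close>

lemma radial_system_wronskian:
  assumes s1: "radial_system l n a b" and s2: "radial_system l n a' b'"
    and B: "\<And>r. 0 < r \<Longrightarrow> r \<le> 1/2 \<Longrightarrow> cmod (a r) \<le> B \<and> cmod (b r) \<le> B \<and> cmod (a' r) \<le> B \<and> cmod (b' r) \<le> B"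
    and r: "0 < r" "r < 1"
  shows "a r * b' r = b r * a' r"
proof -
  define W where "W x = of_real x * (a x * b' x - b x * a' x)" for x
  have "\<exists>c. \<forall>x\<in>{0<..<1}. W x = c"
  proof (rule has_vector_derivative_zero_constant)
    fix x :: real assume x: "x \<in> {0<..<1}"
    note 1 = s1[unfolded radial_system_def, rule_format, OF x]
    note 2 = s2[unfolded radial_system_def, rule_format, OF x]
    have *: "(of_real has_vector_derivative (1::complex)) (at x)"
      by (auto intro!: derivative_eq_intros simp: has_vector_derivative_def scaleR_conv_of_real)
    \<comment> \<open>The trace of the system is \<open>n / r - (n + 1) / r = - 1 / r\<close>, so
      the plain Wronskian \<open>w\<close> satisfies \<open>w' = - w / r\<close>; the factor
      \<open>r\<close> in \<open>W\<close> cancels this decay.\<close>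
    have "(W has_vector_derivative 0) (at x)"
      unfolding W_def[abs_def]
      by (rule has_vector_derivative_eq_rhs[OF has_vector_derivative_mult[OF * has_vector_derivative_diff[OF
          has_vector_derivative_mult[OF conjunct1[OF 1] conjunct2[OF 2]]
          has_vector_derivative_mult[OF conjunct2[OF 1] conjunct1[OF 2]]]]])
        (use x in \<open>simp add: field_simps\<close>)
    then show "(W has_vector_derivative 0) (at x within {0<..<1})" by (rule has_vector_derivative_at_within)
  qed auto
  then obtain c where c: "\<And>x. 0 < x \<Longrightarrow> x < 1 \<Longrightarrow> W x = c" by force
  have B0: "B \<ge> 0" using B[of "1/2"] by (auto intro: order_trans[OF norm_ge_zero])
  have W: "cmod c \<le> x * (2 * B\<^sup>2)" if "0 < x" "x \<le> 1/2" for x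
  proof -
    have "cmod (W x) \<le> x * (cmod (a x) * cmod (b' x) + cmod (b x) * cmod (a' x))"
      using that by (simp add: W_def norm_mult) (metis norm_mult norm_triangle_ineq4)
    also have "\<dots> \<le> x * (B * B + B * B)"
      using that B[OF that] B0 by (intro mult_left_mono add_mono mult_mono) auto
    finally show ?thesis using c[of x] that by (simp add: power2_eq_square)
  qed
  have "c = 0"
  proof (rule ccontr)
    assume "c \<noteq> 0"
    then have c0: "cmod c > 0" by simp
    \<comment> \<open>Small enough that \<open>2 * x * B^2 < cmod c\<close>; the summand 1 keeps the
      denominator positive when \<open>B = 0\<close>.\<close>
    define x where "x = min (1/2) (cmod c / (4 * B\<^sup>2 + 1))"
    have x: "0 < x" "x \<le> 1/2" "x \<le> cmod c / (4 * B\<^sup>2 + 1)"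
      unfolding x_def using c0 by (intro min.cobounded1 min.cobounded2 | simp add: add_nonneg_pos)+
    have "x * (4 * B\<^sup>2 + 1) \<le> cmod c" using x(3) by (simp add: pos_le_divide_eq add_nonneg_pos)
    moreover have "x * B\<^sup>2 \<ge> 0" using x(1) by simp
    ultimately show False using W[OF x(1,2)] x(1) by (simp add: algebra_simps)
  qed
  with c[OF r] r show ?thesis by (simp add: W_def)
qed

text \<open>Subtract the multiple of \<open>(a', b')\<close> that makes the first component vanish
  at \<open>\<rho>\<close>. The vanishing Wronskian forces the second component to vanish there as
  well, and uniqueness for the initial value problem does the rest.\<close>

lemma radial_system_proportional:
  assumes s1: "radial_system l n a b" and s2: "radial_system l n a' b'"
    and B: "\<And>r. 0 < r \<Longrightarrow> r \<le> 1/2 \<Longrightarrow> cmod (a r) \<le> B \<and> cmod (b r) \<le> B \<and> cmod (a' r) \<le> B \<and> cmod (b' r) \<le> B"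
    and \<rho>: "0 < \<rho>" "\<rho> < 1" "a' \<rho> \<noteq> 0" and r: "0 < r" "r < 1"
  shows "a r = a \<rho> / a' \<rho> * a' r"
proof -
  define c where "c = a \<rho> / a' \<rho>"
  have "a r - c * a' r = 0"
  proof (rule radial_system_unique[OF radial_system_combination[OF s1 s2] \<rho>(1,2) _ _ r])
    show "a \<rho> - c * a' \<rho> = 0" using \<rho> by (simp add: c_def)
    show "b \<rho> - c * b' \<rho> = 0"
      using radial_system_wronskian[OF s1 s2 B \<rho>(1,2)] \<rho> by (simp add: c_def field_simps)
  qed
  then show ?thesis by (simp add: c_def)
qed

section \<open>Separately holomorphic functions on the bidisc\<close>

text \<open>A working form of \<open>holomorphic2_on\<close> suited to one-variable tools (slices,
  Cauchy integrals, uniform limits); \<open>holomorphic2_on_bidisc_iff\<close> shows that the two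
  agree on the bidisc.\<close>

definition sep_holomorphic :: "(complex \<times> complex \<Rightarrow> complex) \<Rightarrow> bool" where
  "sep_holomorphic F \<longleftrightarrow> continuous_on bidisc F \<and>
     (\<forall>w\<in>disc. (\<lambda>z. F (z, w)) holomorphic_on disc) \<and> (\<forall>z\<in>disc. (\<lambda>w. F (z, w)) holomorphic_on disc)"

definition d1 :: "(complex \<times> complex \<Rightarrow> complex) \<Rightarrow> complex \<times> complex \<Rightarrow> complex" where
  "d1 F = (\<lambda>(z, w). deriv (\<lambda>u. F (u, w)) z)"

definition d2 :: "(complex \<times> complex \<Rightarrow> complex) \<Rightarrow> complex \<times> complex \<Rightarrow> complex" where
  "d2 F = (\<lambda>(z, w). deriv (\<lambda>v. F (z, v)) w)"

lemma d1_swap: "d1 F = d2 (F \<circ> prod.swap) \<circ> prod.swap"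
  by (auto simp: d1_def d2_def)

lemma sep_holomorphic_swap: "sep_holomorphic F \<Longrightarrow> sep_holomorphic (F \<circ> prod.swap)"
  unfolding sep_holomorphic_def
  by (auto intro!: continuous_on_compose2[of bidisc F bidisc prod.swap] continuous_on_swap)

lemma has_field_derivative_d1:
  assumes "sep_holomorphic F" "z \<in> disc" "w \<in> disc"
  shows "((\<lambda>u. F (u, w)) has_field_derivative d1 F (z, w)) (at z)"
  using assms unfolding sep_holomorphic_def d1_def by (auto intro!: holomorphic_derivI[of _ disc])

lemma has_field_derivative_d2:
  assumes "sep_holomorphic F" "z \<in> disc" "w \<in> disc"
  shows "((\<lambda>v. F (z, v)) has_field_derivative d2 F (z, w)) (at w)"
  using assms unfolding sep_holomorphic_def d2_def by (auto intro!: holomorphic_derivI[of _ disc])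

definition circ :: "real \<Rightarrow> real \<Rightarrow> complex" where
  "circ \<rho> t = of_real \<rho> * exp (2 * of_real pi * \<i> * of_real t)"

lemma norm_circ [simp]: "cmod (circ \<rho> t) = \<bar>\<rho>\<bar>"
  by (simp add: circ_def norm_mult)

lemma continuous_on_circ [continuous_intros]:
  "continuous_on S f \<Longrightarrow> continuous_on S (\<lambda>x. circ \<rho> (f x))"
  unfolding circ_def by (intro continuous_intros)

text \<open>Cauchy's formula for the derivative over a circle centred at 0 that serves all
  \<open>w\<close> with \<open>cmod w < \<rho>\<close> at once. The integrand contains
  \<open>F\<close> itself instead of a derivative, so the regularity of \<open>d2 F\<close> in both
  variables follows from theorems on parameter integrals.\<close>

lemma d2_integral:
  assumes F: "sep_holomorphic F" and z: "z \<in> disc" and \<rho>: "\<rho> < 1" and w: "cmod w < \<rho>"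
  shows "d2 F (z, w) = integral (cbox 0 1) (\<lambda>t. F (z, circ \<rho> t) * (circ \<rho> t / (circ \<rho> t - w)\<^sup>2))"
proof -
  have \<rho>0: "\<rho> > 0" using w norm_ge_zero[of w] by linarith
  have "(\<lambda>v. F (z, v)) holomorphic_on disc"
    using F z unfolding sep_holomorphic_def by blast
  then have hol: "(\<lambda>v. F (z, v)) holomorphic_on cball 0 \<rho>"
    by (rule holomorphic_on_subset) (use \<rho> in auto)
  have "((\<lambda>v. F (z, v)) has_field_derivative
     (1 / (2 * of_real pi * \<i>) * contour_integral (circlepath 0 \<rho>) (\<lambda>u. F (z, u) / (u - w)\<^sup>2))) (at w)"
    by (rule Cauchy_derivative_integral_circlepath(2))
       (use hol w in \<open>auto intro: holomorphic_on_imp_continuous_on holomorphic_on_subset\<close>)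
  then have "d2 F (z, w) = 1 / (2 * of_real pi * \<i>) * contour_integral (circlepath 0 \<rho>) (\<lambda>u. F (z, u) / (u - w)\<^sup>2)"
    unfolding d2_def by (simp add: DERIV_imp_deriv)
  also have "contour_integral (circlepath 0 \<rho>) (\<lambda>u. F (z, u) / (u - w)\<^sup>2) =
     integral {0..1} (\<lambda>t. 2 * of_real pi * \<i> * (F (z, circ \<rho> t) * (circ \<rho> t / (circ \<rho> t - w)\<^sup>2)))"
    unfolding contour_integral_integral
  proof (rule integral_cong)
    fix t :: real
    have "vector_derivative (circlepath 0 \<rho>) (at t) = 2 * of_real pi * \<i> * circ \<rho> t"
      by (simp add: vector_derivative_circlepath circ_def)
    moreover have "circlepath 0 \<rho> t = circ \<rho> t" by (simp add: circlepath circ_def)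
    ultimately show "F (z, circlepath 0 \<rho> t) / (circlepath 0 \<rho> t - w)\<^sup>2 * vector_derivative (circlepath 0 \<rho>) (at t) =
        2 * of_real pi * \<i> * (F (z, circ \<rho> t) * (circ \<rho> t / (circ \<rho> t - w)\<^sup>2))" by simp
  qed
  finally show ?thesis by (simp only: integral_mult_right) simp
qed

lemma kernel_nonzero: "cmod w < \<rho> \<Longrightarrow> circ \<rho> t - w \<noteq> 0"
  using norm_circ[of \<rho> t] by force

lemma continuous_on_d2:
  assumes F: "sep_holomorphic F"
  shows "continuous_on bidisc (d2 F)"
proof -
  have *: "continuous_on (disc \<times> ball 0 \<rho>) (d2 F)" if \<rho>: "0 < \<rho>" "\<rho> < 1" for \<rho>
  proof -
    have cF: "continuous_on ((disc \<times> ball 0 \<rho>) \<times> {0..1}) (\<lambda>p. F (fst (fst p), circ \<rho> (snd p)))"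
      by (rule continuous_on_compose2[of bidisc F])
         (use F \<rho> in \<open>auto simp: sep_holomorphic_def intro!: continuous_intros\<close>)
    have "continuous_on (disc \<times> ball 0 \<rho>)
        (\<lambda>p. integral (cbox 0 1) (\<lambda>t. F (fst p, circ \<rho> t) * (circ \<rho> t / (circ \<rho> t - snd p)\<^sup>2)))"
      by (rule integral_continuous_on_param)
         (auto simp: case_prod_unfold kernel_nonzero intro!: continuous_intros cF)
    then show ?thesis
      by (rule continuous_on_eq) (use d2_integral[OF F _ \<rho>(2)] in auto)
  qed
  have "isCont (d2 F) p" if p: "p \<in> bidisc" for p
  proof -
    obtain \<rho> where \<rho>: "cmod (snd p) < \<rho>" "\<rho> < 1" using p dense[of "cmod (snd p)" 1] by auto
    moreover have "0 < \<rho>" using \<rho> norm_ge_zero[of "snd p"] by linarith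
    ultimately show ?thesis
      using *[of \<rho>] p by (intro continuous_on_interior[of "disc \<times> ball 0 \<rho>"]) (auto simp: interior_open open_Times)
  qed
  then show ?thesis by (rule continuous_at_imp_continuous_on[rule_format])
qed

lemma continuous_on_d1:
  assumes "sep_holomorphic F"
  shows "continuous_on bidisc (d1 F)"
  unfolding d1_swap
  by (intro continuous_on_compose continuous_on_swap continuous_on_subset[OF continuous_on_d2] sep_holomorphic_swap assms) auto

text \<open>Holomorphy in \<open>w\<close> is the one-variable fact about derivatives. In
  \<open>z\<close> it comes from differentiating the Cauchy integral under the integral sign, which
  rests on the continuity of \<open>d1 F\<close>.\<close>

lemma sep_holomorphic_d2:
  assumes F: "sep_holomorphic F"
  shows "sep_holomorphic (d2 F)"
  unfolding sep_holomorphic_def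
proof (intro conjI ballI)
  show "continuous_on bidisc (d2 F)" by (rule continuous_on_d2[OF F])
  show "(\<lambda>w. d2 F (z, w)) holomorphic_on disc" if "z \<in> disc" for z
    using F that unfolding sep_holomorphic_def d2_def prod.case by (intro holomorphic_deriv) auto
  fix w :: complex assume w: "w \<in> disc"
  then obtain \<rho> where \<rho>: "cmod w < \<rho>" "\<rho> < 1" using dense[of "cmod w" 1] by auto
  have \<rho>0: "\<rho> > 0" using \<rho> norm_ge_zero[of w] by linarith
  have nz: "circ \<rho> t \<noteq> w" for t using kernel_nonzero[OF \<rho>(1), of t] by simp
  have cF: "continuous_on (disc \<times> {0..1}) (\<lambda>p. G (fst p, circ \<rho> (snd p)))" if "continuous_on bidisc G" for G :: "complex \<times> complex \<Rightarrow> complex"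
    by (rule continuous_on_compose2[OF that]) (use \<rho> \<rho>0 in \<open>auto intro!: continuous_intros\<close>)
  have "(\<lambda>z. integral (cbox 0 1) (\<lambda>t. F (z, circ \<rho> t) * (circ \<rho> t / (circ \<rho> t - w)\<^sup>2))) holomorphic_on disc"
  proof (rule leibniz_rule_holomorphic)
    fix z t assume z: "z \<in> disc"
    have "((\<lambda>z. F (z, circ \<rho> t)) has_field_derivative d1 F (z, circ \<rho> t)) (at z within disc)"
      by (rule has_field_derivative_at_within[OF has_field_derivative_d1[OF F z]]) (use \<rho> \<rho>0 in auto)
    then show "((\<lambda>z. F (z, circ \<rho> t) * (circ \<rho> t / (circ \<rho> t - w)\<^sup>2)) has_field_derivative
       d1 F (z, circ \<rho> t) * (circ \<rho> t / (circ \<rho> t - w)\<^sup>2)) (at z within disc)"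
      by (rule DERIV_cmult_right)
  next
    fix z :: complex assume "z \<in> disc"
    then have "continuous_on (cbox 0 1) (\<lambda>t. F (z, circ \<rho> t))"
      by (intro continuous_on_compose2[OF F[unfolded sep_holomorphic_def, THEN conjunct1], of _ "\<lambda>t. (z, circ \<rho> t)"])
        (use \<rho> \<rho>0 in \<open>auto intro!: continuous_intros\<close>)
    then show "(\<lambda>t. F (z, circ \<rho> t) * (circ \<rho> t / (circ \<rho> t - w)\<^sup>2)) integrable_on cbox 0 1"
      by (intro integrable_continuous continuous_intros) (auto simp: nz)
  next
    show "continuous_on (disc \<times> cbox 0 1) (\<lambda>(z, t). d1 F (z, circ \<rho> t) * (circ \<rho> t / (circ \<rho> t - w)\<^sup>2))"
      unfolding case_prod_unfold
      by (intro continuous_intros ballI) (auto simp: nz cF[OF continuous_on_d1[OF F]])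
  qed auto
  then show "(\<lambda>z. d2 F (z, w)) holomorphic_on disc"
    by (rule holomorphic_transform) (use d2_integral[OF F _ \<rho>(2,1)] in auto)
qed

lemma sep_holomorphic_d1: "sep_holomorphic F \<Longrightarrow> sep_holomorphic (d1 F)"
  unfolding d1_swap by (intro sep_holomorphic_swap sep_holomorphic_d2)

lemma sep_holomorphic_has_derivative:
  assumes F: "sep_holomorphic F" and p: "p \<in> bidisc"
  shows "(F has_derivative (\<lambda>(h, k). d1 F p * h + d2 F p * k)) (at p)"
proof -
  obtain z w where [simp]: "p = (z, w)" by force
  have zw: "z \<in> disc" "w \<in> disc" using p by auto
  have "((\<lambda>(z, w). F (z, w)) has_derivative
      (\<lambda>(h, k). d1 F (z, w) * h + blinfun_apply (blinfun_mult_right (d2 F (z, w))) k)) (at (z, w) within disc \<times> disc)"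
  proof (rule has_derivative_partialsI)
    show "((\<lambda>z. F (z, w)) has_derivative (*) (d1 F (z, w))) (at z within disc)"
      using has_field_derivative_d1[OF F zw] has_derivative_at_withinI unfolding has_field_derivative_def by blast
    show "((\<lambda>w. F (x, w)) has_derivative blinfun_apply (blinfun_mult_right (d2 F (x, y)))) (at y within disc)"
      if "x \<in> disc" "y \<in> disc" for x y
      using has_field_derivative_d2[OF F that] has_derivative_at_withinI unfolding has_field_derivative_def by auto
    have "continuous_on bidisc (\<lambda>p. blinfun_mult_right (d2 F p))"
      by (intro bounded_linear.continuous_on[OF bounded_linear_blinfun_mult_right] continuous_on_d2 F)
    then show "continuous (at (z, w) within bidisc) (\<lambda>(x, y). blinfun_mult_right (d2 F (x, y)))"
      using zw by (auto simp: continuous_on_eq_continuous_within case_prod_unfold)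
  qed (use zw in auto)
  then show ?thesis
    using at_within_open[OF p] by (simp add: open_Times)
qed

lemma holomorphic2_on_bidisc_iff: "holomorphic2_on F bidisc \<longleftrightarrow> sep_holomorphic F"
proof
  assume F: "holomorphic2_on F bidisc"
  have der: "((\<lambda>u. F (u, w)) has_field_derivative a) (at z) \<and> ((\<lambda>v. F (z, v)) has_field_derivative b) (at w)"
    if "(F has_derivative (\<lambda>(h, k). a * h + b * k)) (at (z, w))" for a b z w
  proof
    have "((\<lambda>u. (u, w)) has_derivative (\<lambda>h. (h, 0))) (at z)" "((\<lambda>v. (z, v)) has_derivative (\<lambda>h. (0, h))) (at w)"
      by (auto intro!: derivative_eq_intros)
    then show "((\<lambda>u. F (u, w)) has_field_derivative a) (at z)" "((\<lambda>v. F (z, v)) has_field_derivative b) (at w)"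
      using has_derivative_compose[of "\<lambda>u. (u, w)" "\<lambda>h. (h, 0)" z UNIV F "\<lambda>(h, k). a * h + b * k"]
        has_derivative_compose[of "\<lambda>v. (z, v)" "\<lambda>h. (0, h)" w UNIV F "\<lambda>(h, k). a * h + b * k"] that
      by (auto simp: has_field_derivative_def)
  qed
  show "sep_holomorphic F"
    unfolding sep_holomorphic_def
  proof (intro conjI ballI)
    show "continuous_on bidisc F"
      using F unfolding holomorphic2_on_def by (meson continuous_at_imp_continuous_on has_derivative_continuous)
    show "(\<lambda>z. F (z, w)) holomorphic_on disc" if "w \<in> disc" for w
      using F der that unfolding holomorphic2_on_def
      unfolding holomorphic_on_open[OF open_ball] by (meson SigmaI)
    show "(\<lambda>w. F (z, w)) holomorphic_on disc" if "z \<in> disc" for z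
      using F der that unfolding holomorphic2_on_def
      unfolding holomorphic_on_open[OF open_ball] by (meson SigmaI)
  qed
next
  assume "sep_holomorphic F"
  then show "holomorphic2_on F bidisc"
    unfolding holomorphic2_on_def using sep_holomorphic_has_derivative by blast
qed

lemma laplace_zw_eq: "laplace_zw F (z, w) = 4 * (1 - z * w)\<^sup>2 * d1 (d2 F) (z, w)"
  by (simp add: laplace_zw_def d1_def d2_def)

lemma has_wirtinger_restriction:
  assumes F: "sep_holomorphic F" and z: "z \<in> disc"
  shows "has_wirtinger (\<lambda>z. F (z, cnj z)) (d1 F (z, cnj z)) (d2 F (z, cnj z)) z"
proof -
  have "((\<lambda>z. (z, cnj z)) has_derivative (\<lambda>h. (h, cnj h))) (at z)"
    by (intro has_derivative_Pair has_derivative_ident bounded_linear.has_derivative[OF bounded_linear_cnj])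
  from has_derivative_compose[OF this sep_holomorphic_has_derivative[OF F, of "(z, cnj z)"]] z
  show ?thesis by (auto simp: has_wirtinger_def)
qed

lemma continuous_on_restriction:
  assumes "sep_holomorphic F"
  shows "continuous_on disc (\<lambda>z. F (z, cnj z))"
  by (rule has_wirtinger_imp_continuous_on) (rule has_wirtinger_restriction[OF assms])

lemma has_wirtinger_unique:
  assumes "has_wirtinger f p q z"
  shows "wirtinger f z = p" "wirtinger_bar f z = q"
  unfolding wirtinger_def wirtinger_bar_def frechet_derivative_at[OF assms[unfolded has_wirtinger_def], symmetric]
  by (simp_all add: algebra_simps)

lemma has_wirtinger_cong:
  assumes "has_wirtinger f p q z" "open S" "z \<in> S" "\<And>x. x \<in> S \<Longrightarrow> f x = g x"
  shows "has_wirtinger g p q z"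
  using has_derivative_transform_within_open[OF assms(1)[unfolded has_wirtinger_def] assms(2,3)] assms(4)
  unfolding has_wirtinger_def by blast

text \<open>Along \<open>w = cnj z\<close> the values of \<open>d1 G\<close> and \<open>d2 G\<close>
  are the Wirtinger derivatives of the restriction of \<open>G\<close>, so they vanish there
  whenever \<open>G\<close> does. Iteration kills every mixed derivative on this set, in particular
  at the origin.\<close>

lemma bidisc_eq_0_of_restriction:
  assumes F: "sep_holomorphic F" and 0: "\<And>z. z \<in> disc \<Longrightarrow> F (z, cnj z) = 0" and p: "p \<in> bidisc"
  shows "F p = 0"
proof -
  have step: "d1 G (z, cnj z) = 0 \<and> d2 G (z, cnj z) = 0"
    if G: "sep_holomorphic G" "\<And>z. z \<in> disc \<Longrightarrow> G (z, cnj z) = 0" and z: "z \<in> disc" for G z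
  proof -
    have "has_wirtinger (\<lambda>z. 0) (d1 G (z, cnj z)) (d2 G (z, cnj z)) z"
      by (rule has_wirtinger_cong[OF has_wirtinger_restriction[OF G(1) z], of disc]) (use G z in auto)
    moreover have "has_wirtinger (\<lambda>z. 0) 0 0 z" by (simp add: has_wirtinger_def)
    ultimately show ?thesis using has_wirtinger_unique by metis
  qed
  have "sep_holomorphic ((d2 ^^ k) F) \<and> (\<forall>z\<in>disc. (d2 ^^ k) F (z, cnj z) = 0)" for k
    by (induction k) (use F 0 step sep_holomorphic_d2 in auto)
  then have k2: "sep_holomorphic ((d2 ^^ k) F)" "\<And>z. z \<in> disc \<Longrightarrow> (d2 ^^ k) F (z, cnj z) = 0" for k
    by auto
  have "sep_holomorphic ((d1 ^^ j) ((d2 ^^ k) F)) \<and> (\<forall>z\<in>disc. (d1 ^^ j) ((d2 ^^ k) F) (z, cnj z) = 0)" for j k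
    by (induction j) (use k2 step sep_holomorphic_d1 in auto)
  then have jk: "(d1 ^^ j) ((d2 ^^ k) F) (0, 0) = 0" for j k
    by (metis complex_cnj_zero centre_in_ball zero_less_one)
  have d1n: "(d1 ^^ j) G (z, w) = (deriv ^^ j) (\<lambda>u. G (u, w)) z" for j G z w
    by (induction j arbitrary: z) (auto simp: d1_def)
  have d2n: "(d2 ^^ j) G (z, w) = (deriv ^^ j) (\<lambda>u. G (z, u)) w" for j G z w
    by (induction j arbitrary: w) (auto simp: d2_def)
  obtain z w where [simp]: "p = (z, w)" by force
  have zw: "z \<in> disc" "w \<in> disc" using p by auto
  \<comment> \<open>The identity theorem is used twice: here in \<open>z\<close> along
    \<open>w = 0\<close>, for each \<open>k\<close>, and then in \<open>w\<close> for fixed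
    \<open>z\<close>, whose Taylor data at 0 are the values just shown to vanish.\<close>
  have "(d2 ^^ k) F (z, 0) = 0" for k
    by (rule holomorphic_fun_eq_0_on_connected[of "\<lambda>z. (d2 ^^ k) F (z, 0)" disc 0])
       (use k2(1)[of k] jk[of _ k] zw in \<open>auto simp: sep_holomorphic_def d1n\<close>)
  then have "F (z, w) = 0"
    by (intro holomorphic_fun_eq_0_on_connected[of "\<lambda>w. F (z, w)" disc 0])
       (use F zw in \<open>auto simp: sep_holomorphic_def d2n\<close>)
  then show ?thesis by simp
qed

section \<open>Eigenfunctions\<close>

lemma has_derivative_imp_has_wirtinger:
  assumes "(f has_derivative L) (at z)"
  shows "has_wirtinger f ((L 1 - \<i> * L \<i>) / 2) ((L 1 + \<i> * L \<i>) / 2) z"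
proof -
  interpret L: bounded_linear L using assms by (rule has_derivative_bounded_linear)
  have "L h = (L 1 - \<i> * L \<i>) / 2 * h + (L 1 + \<i> * L \<i>) / 2 * cnj h" for h
  proof -
    have "L h = L (Re h *\<^sub>R 1 + Im h *\<^sub>R \<i>)" by (rule arg_cong[of _ _ L]) (simp add: complex_eq_iff)
    also have "\<dots> = Re h *\<^sub>R L 1 + Im h *\<^sub>R L \<i>" by (simp only: L.add L.scaleR)
    finally show ?thesis by (simp add: complex_eq_iff field_simps)
  qed
  then show ?thesis unfolding has_wirtinger_def by (intro has_derivative_eq_rhs[OF assms] ext)
qed

lemma C2_on_disc_of_has_wirtinger:
  assumes f: "\<And>z. z \<in> disc \<Longrightarrow> has_wirtinger f (P z) (Q z) z"
    and P: "\<And>z. z \<in> disc \<Longrightarrow> has_wirtinger P (P1 z) (P2 z) z"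
    and Q: "\<And>z. z \<in> disc \<Longrightarrow> has_wirtinger Q (Q1 z) (Q2 z) z"
    and cont: "continuous_on disc P1" "continuous_on disc P2" "continuous_on disc Q1" "continuous_on disc Q2"
  shows "C2_on disc f"
proof -
  \<comment> \<open>The coefficients \<open>p\<close> and \<open>q\<close> of
    \<open>h \<mapsto> p h + q cnj h\<close> enter the space of bounded real-linear maps through the
    bounded linear embeddings \<open>M1\<close> and \<open>M2\<close>, so the derivative of
    \<open>f'\<close> is obtained by composing these with the derivatives of \<open>P\<close> and
    \<open>Q\<close>.\<close>
  define M1 :: "complex \<Rightarrow> complex \<Rightarrow>\<^sub>L complex" where "M1 = blinfun_mult_right"
  define M2 :: "complex \<Rightarrow> complex \<Rightarrow>\<^sub>L complex" where "M2 = (\<lambda>a. blinfun_mult_right a o\<^sub>L Blinfun cnj)"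
  have M: "bounded_linear M1" "bounded_linear M2"
    unfolding M1_def M2_def
    by (auto intro: bounded_linear_blinfun_mult_right
        bounded_linear_compose[OF bounded_bilinear.bounded_linear_left[OF bounded_bilinear_blinfun_compose]])
  have [simp]: "blinfun_apply (M1 a) h = a * h" "blinfun_apply (M2 a) h = a * cnj h" for a h
    by (simp_all add: M1_def M2_def bounded_linear_Blinfun_apply bounded_linear_cnj)
  define f' where "f' z = M1 (P z) + M2 (Q z)" for z
  define f'' where "f'' z = (Blinfun M1 o\<^sub>L (M1 (P1 z) + M2 (P2 z))) + (Blinfun M2 o\<^sub>L (M1 (Q1 z) + M2 (Q2 z)))" for z
  have "(f has_derivative blinfun_apply (f' z)) (at z)" if "z \<in> disc" for z
    by (rule has_derivative_eq_rhs[OF f[OF that, unfolded has_wirtinger_def]])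
       (simp add: fun_eq_iff f'_def blinfun.add_left)
  moreover have "(f' has_derivative blinfun_apply (f'' z)) (at z)" if z: "z \<in> disc" for z
  proof -
    have "(f' has_derivative (\<lambda>h. M1 (P1 z * h + P2 z * cnj h) + M2 (Q1 z * h + Q2 z * cnj h))) (at z)"
      unfolding f'_def[abs_def] using P[OF z] Q[OF z]
      by (intro has_derivative_add bounded_linear.has_derivative[OF M(1)] bounded_linear.has_derivative[OF M(2)])
         (auto simp: has_wirtinger_def)
    then show ?thesis
      by (rule has_derivative_eq_rhs)
         (simp add: f''_def fun_eq_iff blinfun.add_left blinfun_eqI bounded_linear_Blinfun_apply M)
  qed
  moreover have "continuous_on disc f''"
    unfolding f''_def[abs_def]
    by (intro continuous_intros bounded_linear.continuous_on[OF M(1)] bounded_linear.continuous_on[OF M(2)] cont)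
  ultimately show ?thesis unfolding C2_on_def by blast
qed

text \<open>The data that the radial system consumes: the equation enters as the value of the
  \<open>z\<close>-derivative of \<open>Q\<close>, the derivative of \<open>f\<close> by
  \<open>cnj z\<close>, and continuity of \<open>P\<close> and \<open>S\<close> permits
  differentiation under the integral sign. In contrast to \<open>X_disc\<close>, values outside the
  disc are irrelevant.\<close>

definition eigen :: "complex \<Rightarrow> (complex \<Rightarrow> complex) \<Rightarrow> bool" where
  "eigen l f \<longleftrightarrow> (\<exists>P Q S. continuous_on disc P \<and> continuous_on disc S \<and>
     (\<forall>z\<in>disc. has_wirtinger f (P z) (Q z) z \<and>
        has_wirtinger Q (l / (4 * (1 - of_real ((cmod z)\<^sup>2))\<^sup>2) * f z) (S z) z))"

lemma disc_weight_nonzero: "z \<in> disc \<Longrightarrow> 1 - complex_of_real ((cmod z)\<^sup>2) \<noteq> 0"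
proof -
  assume "z \<in> disc"
  then have "(cmod z)\<^sup>2 < 1" by (simp add: power_less_one_iff abs_square_less_1)
  then have "1 - (cmod z)\<^sup>2 \<noteq> 0" by simp
  then show ?thesis by (metis of_real_1 of_real_diff of_real_eq_0_iff)
qed

lemma X_disc_imp_eigen:
  assumes f: "f \<in> X_disc l"
  shows "eigen l f"
proof -
  from f obtain f' f'' where
    f': "\<And>z. z \<in> disc \<Longrightarrow> (f has_derivative blinfun_apply (f' z)) (at z)" and
    f'': "\<And>z. z \<in> disc \<Longrightarrow> (f' has_derivative blinfun_apply (f'' z)) (at z)" and
    cont: "continuous_on disc f''" and
    lap: "\<And>z. z \<in> disc \<Longrightarrow> laplace_disc f z = l * f z"
    unfolding X_disc_def C2_disc_def C2_on_def by blast
  define P where "P z = (blinfun_apply (f' z) 1 - \<i> * blinfun_apply (f' z) \<i>) / 2" for z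
  define Q where "Q z = (blinfun_apply (f' z) 1 + \<i> * blinfun_apply (f' z) \<i>) / 2" for z
  define L where "L z h = (blinfun_apply (blinfun_apply (f'' z) h) 1 + \<i> * blinfun_apply (blinfun_apply (f'' z) h) \<i>) / 2" for z h
  define R where "R z = (L z 1 - \<i> * L z \<i>) / 2" for z
  define S where "S z = (L z 1 + \<i> * L z \<i>) / 2" for z
  have fw: "has_wirtinger f (P z) (Q z) z" if "z \<in> disc" for z
    unfolding P_def Q_def by (rule has_derivative_imp_has_wirtinger[OF f'[OF that]])
  have Qw: "has_wirtinger Q (R z) (S z) z" if "z \<in> disc" for z
    unfolding R_def S_def
  proof (rule has_derivative_imp_has_wirtinger)
    note [derivative_intros] = bounded_linear.has_derivative[OF blinfun.bounded_linear_left f''[OF that]]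
    show "(Q has_derivative L z) (at z)"
      unfolding Q_def[abs_def] L_def[abs_def]
      by (auto intro!: derivative_eq_intros)
  qed
  have "R z = l / (4 * (1 - of_real ((cmod z)\<^sup>2))\<^sup>2) * f z" if z: "z \<in> disc" for z
  proof -
    have "has_wirtinger (wirtinger_bar f) (R z) (S z) z"
      by (rule has_wirtinger_cong[OF Qw[OF z], of disc]) (use z has_wirtinger_unique(2)[OF fw] in auto)
    then have "4 * (1 - of_real ((cmod z)\<^sup>2))\<^sup>2 * R z = l * f z"
      using lap[OF z] has_wirtinger_unique(1) unfolding laplace_disc_def by metis
    then show ?thesis using disc_weight_nonzero[OF z] by (simp add: field_simps)
  qed
  moreover have "continuous_on disc f'"
    using f'' by (meson continuous_at_imp_continuous_on has_derivative_continuous)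
  then have "continuous_on disc P" unfolding P_def[abs_def] by (intro continuous_intros) auto
  moreover have "continuous_on disc S"
    unfolding S_def[abs_def] L_def by (intro continuous_intros cont) auto
  ultimately show ?thesis unfolding eigen_def using fw Qw by metis
qed

definition eigen2 :: "complex \<Rightarrow> (complex \<times> complex \<Rightarrow> complex) \<Rightarrow> bool" where
  "eigen2 l F \<longleftrightarrow> sep_holomorphic F \<and> (\<forall>p\<in>bidisc. laplace_zw F p = l * F p)"

lemma X_bidisc_iff: "F \<in> X_bidisc l \<longleftrightarrow> F \<in> extensional bidisc \<and> eigen2 l F"
  by (auto simp: X_bidisc_def H_bidisc_def eigen2_def holomorphic2_on_bidisc_iff)

text \<open>Restriction to \<open>w = cnj z\<close> turns \<open>d1\<close> and \<open>d2\<close>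
  into the two Wirtinger derivatives and \<open>z w\<close> into \<open>(cmod z)^2\<close>, hence
  one Laplacian into the other. This serves for the modes, for linearity and for
  surjectivity.\<close>

lemma eigen2_imp_X_disc:
  assumes "eigen2 l F"
  shows "(\<lambda>z\<in>disc. F (z, cnj z)) \<in> X_disc l"
proof -
  have F: "sep_holomorphic F" and lap: "\<And>p. p \<in> bidisc \<Longrightarrow> laplace_zw F p = l * F p"
    using assms by (auto simp: eigen2_def)
  define f where "f = (\<lambda>z\<in>disc. F (z, cnj z))"
  have fw: "has_wirtinger f (d1 F (z, cnj z)) (d2 F (z, cnj z)) z" if "z \<in> disc" for z
    by (rule has_wirtinger_cong[OF has_wirtinger_restriction[OF F that], of disc]) (use that in \<open>auto simp: f_def\<close>)
  note w = has_wirtinger_restriction[OF sep_holomorphic_d1[OF F]] has_wirtinger_restriction[OF sep_holomorphic_d2[OF F]]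
  have "C2_on disc f"
    by (rule C2_on_disc_of_has_wirtinger[OF fw w]) (auto intro!: continuous_on_restriction sep_holomorphic_d1 sep_holomorphic_d2 F)
  moreover have "laplace_disc f z = l * f z" if z: "z \<in> disc" for z
  proof -
    have "has_wirtinger (wirtinger_bar f) (d1 (d2 F) (z, cnj z)) (d2 (d2 F) (z, cnj z)) z"
      by (rule has_wirtinger_cong[OF w(2)[OF z], of disc]) (use z has_wirtinger_unique(2)[OF fw] in auto)
    then have "laplace_disc f z = 4 * (1 - of_real ((cmod z)\<^sup>2))\<^sup>2 * d1 (d2 F) (z, cnj z)"
      by (simp add: laplace_disc_def has_wirtinger_unique(1))
    also have "\<dots> = laplace_zw F (z, cnj z)"
      by (simp add: laplace_zw_eq complex_norm_square[symmetric])
    also have "\<dots> = l * f z" using lap[of "(z, cnj z)"] z by (simp add: f_def)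
    finally show ?thesis .
  qed
  ultimately show ?thesis by (auto simp: X_disc_def C2_disc_def f_def)
qed

lemma d2_cong: "(\<And>p. p \<in> bidisc \<Longrightarrow> F p = G p) \<Longrightarrow> p \<in> bidisc \<Longrightarrow> d2 F p = d2 G p"
  unfolding d2_def by (auto intro!: deriv_cong_ev eventually_nhds_in_open[of disc, THEN eventually_mono])

lemma d1_cong: "(\<And>p. p \<in> bidisc \<Longrightarrow> F p = G p) \<Longrightarrow> p \<in> bidisc \<Longrightarrow> d1 F p = d1 G p"
  unfolding d1_def by (auto intro!: deriv_cong_ev eventually_nhds_in_open[of disc, THEN eventually_mono])

lemma sep_holomorphic_cong:
  assumes "\<And>p. p \<in> bidisc \<Longrightarrow> F p = G p"
  shows "sep_holomorphic F \<longleftrightarrow> sep_holomorphic G"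
  unfolding sep_holomorphic_def using assms
  by (intro conj_cong ball_cong continuous_on_cong holomorphic_cong refl) auto

lemma eigen2_cong:
  assumes "\<And>p. p \<in> bidisc \<Longrightarrow> F p = G p"
  shows "eigen2 l F \<longleftrightarrow> eigen2 l G"
proof -
  have "laplace_zw F p = laplace_zw G p" if "p \<in> bidisc" for p
    using d1_cong[OF d2_cong[OF assms] that] by (cases p) (simp add: laplace_zw_eq)
  then show ?thesis unfolding eigen2_def using sep_holomorphic_cong[OF assms] assms by auto
qed

lemma sep_holomorphic_linear:
  assumes "sep_holomorphic F" "sep_holomorphic G"
  shows "sep_holomorphic (\<lambda>p. a * F p + b * G p)"
  using assms unfolding sep_holomorphic_def by (auto intro!: continuous_intros holomorphic_intros)

lemma d_linear:
  assumes "sep_holomorphic F" "sep_holomorphic G" "p \<in> bidisc"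
  shows "d1 (\<lambda>p. a * F p + b * G p) p = a * d1 F p + b * d1 G p"
    and "d2 (\<lambda>p. a * F p + b * G p) p = a * d2 F p + b * d2 G p"
proof -
  obtain z w where [simp]: "p = (z, w)" and zw: "z \<in> disc" "w \<in> disc" using assms(3) by auto
  have "((\<lambda>u. a * F (u, w) + b * G (u, w)) has_field_derivative a * d1 F (z, w) + b * d1 G (z, w)) (at z)"
    by (intro DERIV_add DERIV_cmult has_field_derivative_d1 assms zw)
  then show "d1 (\<lambda>p. a * F p + b * G p) p = a * d1 F p + b * d1 G p"
    by (simp add: d1_def DERIV_imp_deriv)
  have "((\<lambda>v. a * F (z, v) + b * G (z, v)) has_field_derivative a * d2 F (z, w) + b * d2 G (z, w)) (at w)"
    by (intro DERIV_add DERIV_cmult has_field_derivative_d2 assms zw)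
  then show "d2 (\<lambda>p. a * F p + b * G p) p = a * d2 F p + b * d2 G p"
    by (simp add: d2_def DERIV_imp_deriv)
qed

lemma eigen2_linear:
  assumes "eigen2 l F" "eigen2 l G"
  shows "eigen2 l (\<lambda>p. a * F p + b * G p)"
proof -
  have F: "sep_holomorphic F" "sep_holomorphic G" using assms by (auto simp: eigen2_def)
  have "laplace_zw (\<lambda>p. a * F p + b * G p) p = l * (a * F p + b * G p)" if p: "p \<in> bidisc" for p
  proof -
    have "d1 (d2 (\<lambda>p. a * F p + b * G p)) p = d1 (\<lambda>p. a * d2 F p + b * d2 G p) p"
      by (rule d1_cong[OF d_linear(2)[OF F] p])
    also have "\<dots> = a * d1 (d2 F) p + b * d1 (d2 G) p"
      by (intro d_linear sep_holomorphic_d2 F p)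
    finally have "laplace_zw (\<lambda>p. a * F p + b * G p) p = a * laplace_zw F p + b * laplace_zw G p"
      by (cases p) (simp add: laplace_zw_eq algebra_simps)
    moreover have "laplace_zw F p = l * F p" "laplace_zw G p = l * G p"
      using assms p unfolding eigen2_def by blast+
    ultimately show ?thesis by (simp add: algebra_simps)
  qed
  then show ?thesis using sep_holomorphic_linear[OF F] by (simp add: eigen2_def)
qed

lemma eigen2_zero: "eigen2 l (\<lambda>p. 0)"
  by (simp add: eigen2_def sep_holomorphic_def laplace_zw_def case_prod_unfold)

lemma eigen2_sum:
  assumes "\<And>k. k \<in> A \<Longrightarrow> eigen2 l (u k)"
  shows "eigen2 l (\<lambda>p. \<Sum>k\<in>A. u k p)"
  using assms
proof (induction A rule: infinite_finite_induct)
  case (insert x A)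
  then show ?case using eigen2_linear[of l "u x" "\<lambda>p. \<Sum>k\<in>A. u k p" 1 1] by simp
qed (auto intro: eigen2_zero)

section \<open>Locally uniform limits on the bidisc\<close>

lemma uniform_limit_slice:
  assumes "uniform_limit (A \<times> B) u F G"
  shows "w \<in> B \<Longrightarrow> uniform_limit A (\<lambda>n z. u n (z, w)) (\<lambda>z. F (z, w)) G"
    and "z \<in> A \<Longrightarrow> uniform_limit B (\<lambda>n w. u n (z, w)) (\<lambda>w. F (z, w)) G"
proof -
  have ev: "\<forall>\<^sub>F n in G. \<forall>p\<in>A \<times> B. dist (u n p) (F p) < e" if "e > 0" for e
    using uniform_limitD[OF assms that] .
  show "w \<in> B \<Longrightarrow> uniform_limit A (\<lambda>n z. u n (z, w)) (\<lambda>z. F (z, w)) G"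
    by (rule uniform_limitI, rule eventually_mono[OF ev]) auto
  show "z \<in> A \<Longrightarrow> uniform_limit B (\<lambda>n w. u n (z, w)) (\<lambda>w. F (z, w)) G"
    by (rule uniform_limitI, rule eventually_mono[OF ev]) auto
qed

text \<open>Weierstrass' theorem in each variable gives holomorphic slices. For the mixed
  derivative, Cauchy's inequality in the second variable makes \<open>d2 (u n)\<close> converge
  uniformly in the first one, and Weierstrass' theorem then handles the remaining
  derivative.\<close>

lemma sep_holomorphic_uniform_limit:
  assumes u: "\<And>n. sep_holomorphic (u n)"
    and lim: "\<And>\<rho>. \<rho> < 1 \<Longrightarrow> uniform_limit (cball 0 \<rho> \<times> cball 0 \<rho>) u F sequentially"
  shows "sep_holomorphic F"
    and "p \<in> bidisc \<Longrightarrow> (\<lambda>n. d1 (d2 (u n)) p) \<longlonglongrightarrow> d1 (d2 F) p"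
proof -
  have room: "\<exists>\<rho>. cmod z < \<rho> \<and> cmod w < \<rho> \<and> \<rho> < 1" if "z \<in> disc" "w \<in> disc" for z w
    using dense[of "max (cmod z) (cmod w)" 1] that by auto
  show F: "sep_holomorphic F"
    unfolding sep_holomorphic_def
  proof (intro conjI ballI)
    have "isCont F p" if p: "p \<in> bidisc" for p
    proof -
      obtain \<rho> where \<rho>: "cmod (fst p) < \<rho>" "cmod (snd p) < \<rho>" "\<rho> < 1" using room p by force
      have "continuous_on (cball 0 \<rho> \<times> cball 0 \<rho>) F"
      proof (rule uniform_limit_theorem[OF _ lim[OF \<rho>(3)]])
        have "continuous_on (cball 0 \<rho> \<times> cball 0 \<rho>) (u n)" for n
          by (rule continuous_on_subset[of bidisc]) (use u \<rho> in \<open>auto simp: sep_holomorphic_def\<close>)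
        then show "\<forall>\<^sub>F n in sequentially. continuous_on (cball 0 \<rho> \<times> cball 0 \<rho>) (u n)" by simp
      qed simp
      then have "continuous_on (ball 0 \<rho> \<times> ball 0 \<rho>) F" by (rule continuous_on_subset) auto
      then show ?thesis
        by (rule continuous_on_interior) (use \<rho> in \<open>auto simp: interior_open open_Times mem_Times_iff\<close>)
    qed
    then show "continuous_on bidisc F" by (rule continuous_at_imp_continuous_on[rule_format])
    show "(\<lambda>z. F (z, w)) holomorphic_on disc" if w: "w \<in> disc" for w
    proof (rule holomorphic_uniform_sequence[of disc "\<lambda>n z. u n (z, w)"])
      show "(\<lambda>z. u n (z, w)) holomorphic_on disc" for n using u w by (auto simp: sep_holomorphic_def)
      fix z :: complex assume z: "z \<in> disc"
      obtain \<rho> where \<rho>: "cmod z < \<rho>" "cmod w < \<rho>" "\<rho> < 1" using room z w by blast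
      have sub: "cball z (\<rho> - cmod z) \<subseteq> cball 0 \<rho>"
        by (auto simp: dist_norm) (smt (verit) norm_minus_commute norm_triangle_sub)
      have "uniform_limit (cball z (\<rho> - cmod z)) (\<lambda>n z. u n (z, w)) (\<lambda>z. F (z, w)) sequentially"
        by (rule uniform_limit_on_subset[OF uniform_limit_slice(1)[OF lim[OF \<rho>(3)]] sub]) (use \<rho> in auto)
      then show "\<exists>d>0. cball z d \<subseteq> disc \<and> uniform_limit (cball z d) (\<lambda>n z. u n (z, w)) (\<lambda>z. F (z, w)) sequentially"
        using \<rho> sub by (intro exI[of _ "\<rho> - cmod z"]) auto
    qed auto
    show "(\<lambda>w. F (z, w)) holomorphic_on disc" if z: "z \<in> disc" for z
    proof (rule holomorphic_uniform_sequence[of disc "\<lambda>n w. u n (z, w)"])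
      show "(\<lambda>w. u n (z, w)) holomorphic_on disc" for n using u z by (auto simp: sep_holomorphic_def)
      fix w :: complex assume w: "w \<in> disc"
      obtain \<rho> where \<rho>: "cmod z < \<rho>" "cmod w < \<rho>" "\<rho> < 1" using room z w by blast
      have sub: "cball w (\<rho> - cmod w) \<subseteq> cball 0 \<rho>"
        by (auto simp: dist_norm) (smt (verit) norm_minus_commute norm_triangle_sub)
      have "uniform_limit (cball w (\<rho> - cmod w)) (\<lambda>n w. u n (z, w)) (\<lambda>w. F (z, w)) sequentially"
        by (rule uniform_limit_on_subset[OF uniform_limit_slice(2)[OF lim[OF \<rho>(3)]] sub]) (use \<rho> in auto)
      then show "\<exists>d>0. cball w d \<subseteq> disc \<and> uniform_limit (cball w d) (\<lambda>n w. u n (z, w)) (\<lambda>w. F (z, w)) sequentially"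
        using \<rho> sub by (intro exI[of _ "\<rho> - cmod w"]) auto
    qed auto
  qed
  assume "p \<in> bidisc"
  then obtain z w where [simp]: "p = (z, w)" and zw: "z \<in> disc" "w \<in> disc" by auto
  obtain \<rho> where \<rho>: "cmod z < \<rho>" "cmod w < \<rho>" "\<rho> < 1" using room zw by blast
  \<comment> \<open>The disc of radius \<open>\<delta>\<close> about \<open>w\<close> stays where
    the convergence is uniform; there Cauchy's inequality turns the bound
    \<open>e * \<delta> / 2\<close> for \<open>u n - F\<close> into \<open>e / 2\<close> for the
    derivatives.\<close>
  define \<delta> where "\<delta> = \<rho> - cmod w"
  have \<delta>: "\<delta> > 0" using \<rho> by (simp add: \<delta>_def)
  have sub: "cball w \<delta> \<subseteq> cball 0 \<rho>"
    unfolding \<delta>_def by (auto simp: dist_norm) (smt (verit) norm_minus_commute norm_triangle_sub)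
  have sub1: "cball w \<delta> \<subseteq> disc" by (rule order_trans[OF sub]) (use \<rho> in auto)
  have "uniform_limit (ball 0 \<rho>) (\<lambda>n x. d2 (u n) (x, w)) (\<lambda>x. d2 F (x, w)) sequentially"
  proof (rule uniform_limitI)
    fix e :: real assume e: "e > 0"
    have "\<forall>\<^sub>F n in sequentially. \<forall>p\<in>cball 0 \<rho> \<times> cball 0 \<rho>. dist (u n p) (F p) < e * \<delta> / 2"
      by (rule uniform_limitD[OF lim[OF \<rho>(3)]]) (use e \<delta> in simp)
    then show "\<forall>\<^sub>F n in sequentially. \<forall>x\<in>ball 0 \<rho>. dist (d2 (u n) (x, w)) (d2 F (x, w)) < e"
    proof eventually_elim
      case (elim n)
      show ?case
      proof
        fix x :: complex assume x: "x \<in> ball 0 \<rho>"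
        then have xd: "x \<in> disc" using \<rho> by auto
        have hol: "(\<lambda>v. 1 * u n (x, v) + (-1) * F (x, v)) holomorphic_on disc"
          using sep_holomorphic_linear[OF u F, of 1 n "-1"] xd by (auto simp: sep_holomorphic_def)
        have "cmod ((deriv ^^ 1) (\<lambda>v. 1 * u n (x, v) + (-1) * F (x, v)) w) \<le> fact 1 * (e * \<delta> / 2) / \<delta> ^ 1"
        proof (rule Cauchy_inequality)
          show "(\<lambda>v. 1 * u n (x, v) + (-1) * F (x, v)) holomorphic_on ball w \<delta>"
            by (rule holomorphic_on_subset[OF hol order_trans[OF ball_subset_cball sub1]])
          show "continuous_on (cball w \<delta>) (\<lambda>v. 1 * u n (x, v) + (-1) * F (x, v))"
            by (rule holomorphic_on_imp_continuous_on[OF holomorphic_on_subset[OF hol sub1]])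
          fix v assume "cmod (w - v) = \<delta>"
          then have "v \<in> cball 0 \<rho>" using sub by (auto simp: dist_norm)
          moreover have "x \<in> cball 0 \<rho>" using x by auto
          ultimately have "dist (u n (x, v)) (F (x, v)) < e * \<delta> / 2" using elim by blast
          then show "cmod (1 * u n (x, v) + (-1) * F (x, v)) \<le> e * \<delta> / 2"
            by (simp add: dist_norm)
        qed (rule \<delta>)
        moreover have "(deriv ^^ 1) (\<lambda>v. 1 * u n (x, v) + (-1) * F (x, v)) w = d2 (u n) (x, w) - d2 F (x, w)"
          using d_linear(2)[OF u F, of "(x, w)" 1 n "-1"] xd zw by (simp add: d2_def)
        ultimately have "cmod (d2 (u n) (x, w) - d2 F (x, w)) \<le> e / 2" using \<delta> by simp
        then show "dist (d2 (u n) (x, w)) (d2 F (x, w)) < e" using e by (simp add: dist_norm)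
      qed
    qed
  qed
  moreover have "\<forall>\<^sub>F n in sequentially. (\<lambda>x. d2 (u n) (x, w)) holomorphic_on ball 0 \<rho>"
  proof (intro always_eventually allI)
    fix n
    have "(\<lambda>x. d2 (u n) (x, w)) holomorphic_on disc"
      using sep_holomorphic_d2[OF u] zw unfolding sep_holomorphic_def by blast
    then show "(\<lambda>x. d2 (u n) (x, w)) holomorphic_on ball 0 \<rho>"
      by (rule holomorphic_on_subset) (use \<rho> in auto)
  qed
  ultimately have "(\<lambda>n. deriv (\<lambda>x. d2 (u n) (x, w)) z) \<longlonglongrightarrow> deriv (\<lambda>x. d2 F (x, w)) z"
    by (rule deriv_complex_uniform_limit) (use \<rho> in auto)
  then show "(\<lambda>n. d1 (d2 (u n)) p) \<longlonglongrightarrow> d1 (d2 F) p"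
    by (simp add: d1_def)
qed

lemma eigen2_uniform_limit:
  assumes u: "\<And>n. eigen2 l (u n)"
    and lim: "\<And>\<rho>. \<rho> < 1 \<Longrightarrow> uniform_limit (cball 0 \<rho> \<times> cball 0 \<rho>) u F sequentially"
  shows "eigen2 l F"
proof -
  have us: "sep_holomorphic (u n)" for n using u by (simp add: eigen2_def)
  have "laplace_zw F p = l * F p" if p: "p \<in> bidisc" for p
  proof (rule LIMSEQ_unique)
    obtain z w where [simp]: "p = (z, w)" by force
    show "(\<lambda>n. laplace_zw (u n) p) \<longlonglongrightarrow> laplace_zw F p"
      using sep_holomorphic_uniform_limit(2)[OF us lim p] by (auto simp: laplace_zw_eq intro!: tendsto_intros)
    obtain \<rho> where "max (cmod z) (cmod w) < \<rho>" "\<rho> < 1" using dense[of "max (cmod z) (cmod w)" 1] p by auto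
    then have "(\<lambda>n. l * u n p) \<longlonglongrightarrow> l * F p"
      by (intro tendsto_intros tendsto_uniform_limitI[OF lim]) auto
    then show "(\<lambda>n. laplace_zw (u n) p) \<longlonglongrightarrow> l * F p"
      using u p by (simp add: eigen2_def)
  qed
  then show ?thesis using sep_holomorphic_uniform_limit(1)[OF us lim] by (simp add: eigen2_def)
qed

section \<open>The eigenfunctions with a single Fourier mode\<close>

text \<open>Division of the equation for \<open>G_n\<close> by \<open>4 (1 - t)^2\<close> and
  comparison of coefficients at \<open>t^k\<close>: the left side \<open>t G'' + (n + 1) G'\<close>
  contributes \<open>(k + 1) (k + 1 + n)\<close> times the next coefficient, and
  \<open>k - j + 1\<close> is the coefficient of \<open>1 / (1 - t)^2\<close> at
  \<open>t^(k - j)\<close>.\<close>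

fun ode_coeff :: "complex \<Rightarrow> nat \<Rightarrow> nat \<Rightarrow> complex" where
  "ode_coeff l n 0 = 1"
| "ode_coeff l n (Suc k) = l / 4 / (of_nat (Suc k) * of_nat (Suc k + n)) *
     (\<Sum>j\<le>k. of_nat (Suc (k - j)) * ode_coeff l n j)"

definition ode_fps :: "complex \<Rightarrow> nat \<Rightarrow> complex fps" where
  "ode_fps l n = Abs_fps (ode_coeff l n)"

definition weight_fps :: "complex fps" where
  "weight_fps = fps_deriv (inverse (1 - fps_X))"

lemma fps_nth_weight: "fps_nth weight_fps k = of_nat (Suc k)"
proof -
  have "inverse (1 - fps_X) = Abs_fps (\<lambda>n. 1 :: complex)"
    by (subst fps_inverse_gp'[symmetric]) (simp add: fps_inverse_idempotent)
  then show ?thesis by (simp add: weight_fps_def)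
qed

lemma has_fps_expansion_weight: "(\<lambda>t. 1 / (1 - t)\<^sup>2) has_fps_expansion weight_fps"
proof -
  have "deriv (\<lambda>t. inverse (1 - t)) has_fps_expansion weight_fps"
    unfolding weight_fps_def
    by (intro has_fps_expansion_deriv has_fps_expansion_inverse has_fps_expansion_diff
        has_fps_expansion_fps_X has_fps_expansion_1) simp
  moreover have "\<forall>\<^sub>F t::complex in nhds 0. deriv (\<lambda>t. inverse (1 - t)) t = 1 / (1 - t)\<^sup>2"
  proof (rule eventually_mono)
    show "\<forall>\<^sub>F t::complex in nhds 0. t \<in> ball 0 1" by (intro eventually_nhds_in_open) auto
    show "deriv (\<lambda>t. inverse (1 - t)) t = 1 / (1 - t)\<^sup>2" if "t \<in> ball 0 1" for t :: complex
      by (rule DERIV_imp_deriv) (use that in \<open>auto intro!: derivative_eq_intros simp: power2_eq_square field_simps\<close>)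
  qed
  ultimately show ?thesis by (subst has_fps_expansion_cong[OF _ refl, symmetric])
qed

lemma fps_conv_radius_weight: "fps_conv_radius weight_fps \<ge> 1"
  and eval_fps_weight: "cmod t < 1 \<Longrightarrow> eval_fps weight_fps t = 1 / (1 - t)\<^sup>2"
proof -
  have *: "(\<lambda>t. 1 / (1 - t)\<^sup>2) holomorphic_on eball (0::complex) 1"
    by (intro holomorphic_intros) (auto simp: eball_def)
  have eq: "fps_expansion (\<lambda>t. 1 / (1 - t)\<^sup>2) 0 = weight_fps"
    by (rule fps_expansion_eqI[OF has_fps_expansion_weight])
  show "fps_conv_radius weight_fps \<ge> 1" using conv_radius_fps_expansion[OF *] by (simp add: eq)
  show "cmod t < 1 \<Longrightarrow> eval_fps weight_fps t = 1 / (1 - t)\<^sup>2"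
    using eval_fps_expansion'[OF *, of t] by (simp add: eq)
qed

text \<open>The Taylor coefficients of \<open>exp (\<mu> t / (1 - t))\<close>. Their recursion arises from that of
  \<^const>\<open>ode_coeff\<close> by omitting the factor \<open>Suc k + n \<ge> Suc n\<close> of the denominator.\<close>

fun maj_coeff :: "real \<Rightarrow> nat \<Rightarrow> real" where
  "maj_coeff \<mu> 0 = 1"
| "maj_coeff \<mu> (Suc k) = \<mu> / of_nat (Suc k) * (\<Sum>j\<le>k. of_nat (Suc (k - j)) * maj_coeff \<mu> j)"

text \<open>The function \<open>h t = exp (\<mu> t / (1 - t))\<close> solves
  \<open>h' = \<mu> h / (1 - t)^2\<close>, which on Taylor coefficients is the recursion of
  \<open>maj_coeff\<close>. Being holomorphic on the unit disc, it is the sum of its Taylor series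
  there.\<close>

lemma maj_coeff_sums:
  assumes s: "0 \<le> s" "s < 1"
  shows "(\<lambda>k. maj_coeff \<mu> k * s ^ k) sums exp (\<mu> * s / (1 - s))"
proof -
  define h where "h t = exp (of_real \<mu> * t / (1 - t))" for t :: complex
  have hol: "h holomorphic_on eball 0 1"
    unfolding h_def by (intro holomorphic_intros) (auto simp: eball_def)
  define E where "E = fps_expansion h 0"
  have E: "h has_fps_expansion E"
    unfolding E_def by (rule has_fps_expansion_fps_expansion[OF open_eball _ hol]) (simp add: eball_def)
  have "deriv h has_fps_expansion fps_deriv E" by (rule has_fps_expansion_deriv[OF E])
  moreover have "(\<lambda>t. (of_real \<mu> * (1 / (1 - t)\<^sup>2)) * h t) has_fps_expansion (fps_const (of_real \<mu>) * weight_fps) * E"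
    by (intro has_fps_expansion_mult has_fps_expansion_cmult_left has_fps_expansion_weight E)
  moreover have "\<forall>\<^sub>F t in nhds 0. deriv h t = (of_real \<mu> * (1 / (1 - t)\<^sup>2)) * h t"
  proof (rule eventually_mono)
    show "\<forall>\<^sub>F t::complex in nhds 0. t \<in> ball 0 1" by (intro eventually_nhds_in_open) auto
    show "deriv h t = (of_real \<mu> * (1 / (1 - t)\<^sup>2)) * h t" if "t \<in> ball 0 1" for t :: complex
    proof (rule DERIV_imp_deriv)
      have t: "1 - t \<noteq> 0" using that by auto
      have "((\<lambda>t. of_real \<mu> * t / (1 - t)) has_field_derivative of_real \<mu> * (1 / (1 - t)\<^sup>2)) (at t)"
        by (rule derivative_eq_intros refl t)+ (use t in \<open>simp add: power2_eq_square field_simps\<close>)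
      then show "(h has_field_derivative (of_real \<mu> * (1 / (1 - t)\<^sup>2)) * h t) (at t)"
        unfolding h_def[abs_def] using DERIV_fun_exp by (simp only: mult.commute[of _ "exp _"])
    qed
  qed
  ultimately have ode: "fps_deriv E = (fps_const (of_real \<mu>) * weight_fps) * E"
    using has_fps_expansion_cong fps_expansion_unique_complex by metis
  have Ek: "fps_nth E k = of_real (maj_coeff \<mu> k)" for k
  proof (induction k rule: less_induct)
    case (less k)
    show ?case
    proof (cases k)
      case 0
      then show ?thesis using has_fps_expansion_imp_0_eq_fps_nth_0[OF E] by (simp add: h_def)
    next
      case (Suc m)
      have "of_nat (Suc m) * fps_nth E (Suc m) = of_real \<mu> * fps_nth (E * weight_fps) m"
        using arg_cong[OF ode, of "\<lambda>F. fps_nth F m"] by (simp add: mult.assoc mult.commute[of E])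
      also have "\<dots> = of_real \<mu> * (\<Sum>j\<le>m. of_nat (Suc (m - j)) * of_real (maj_coeff \<mu> j))"
        unfolding fps_mult_nth atLeast0AtMost
        by (intro arg_cong[of _ _ "(*) (of_real \<mu>)"] refl sum.cong) (use less Suc in \<open>simp_all add: fps_nth_weight mult.commute del: of_nat_Suc\<close>)
      finally have "fps_nth E (Suc m) = of_real \<mu> / of_nat (Suc m) * (\<Sum>j\<le>m. of_nat (Suc (m - j)) * of_real (maj_coeff \<mu> j))"
        by (simp add: field_simps del: of_nat_Suc)
      then show ?thesis using Suc by simp
    qed
  qed
  have "ereal (norm (complex_of_real s)) < fps_conv_radius E"
    using conv_radius_fps_expansion[OF hol] s by (auto simp: E_def intro: less_le_trans[of _ 1])
  from sums_eval_fps[OF this]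
  have "(\<lambda>k. of_real (maj_coeff \<mu> k * s ^ k)) sums eval_fps E (of_real s)" by (simp add: Ek)
  also have "eval_fps E (of_real s) = h (of_real s)"
    unfolding E_def using eval_fps_expansion'[OF hol, of "of_real s"] s by simp
  also have "\<dots> = of_real (exp (\<mu> * s / (1 - s)))" by (simp add: h_def exp_of_real[symmetric])
  finally show ?thesis by (simp only: sums_of_real_iff)
qed

text \<open>The bound without gain is fed into one step of the recursion, whose denominator still
  holds the factor \<open>Suc m + n \<ge> Suc n\<close>. The gain arises only once, since the sum in
  the recursion contains the term \<open>j = 0\<close> of size 1.\<close>

lemma norm_ode_coeff_le:
  shows "cmod (ode_coeff l n k) \<le> maj_coeff (cmod l / 4) k"
    and "k > 0 \<Longrightarrow> cmod (ode_coeff l n k) \<le> maj_coeff (cmod l / 4) k / of_nat (Suc n)"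
proof -
  have nn: "maj_coeff (cmod l / 4) k \<ge> 0" for k
    by (induction "cmod l / 4" k rule: maj_coeff.induct) (auto intro!: mult_nonneg_nonneg divide_nonneg_nonneg sum_nonneg simp del: of_nat_Suc)
  have step: "cmod (ode_coeff l n (Suc m)) \<le> maj_coeff (cmod l / 4) (Suc m) / of_nat (Suc n)"
    if "\<And>j. j \<le> m \<Longrightarrow> cmod (ode_coeff l n j) \<le> maj_coeff (cmod l / 4) j" for m
  proof -
    define T where "T = (\<Sum>j\<le>m. real (Suc (m - j)) * maj_coeff (cmod l / 4) j)"
    have T0: "T \<ge> 0" unfolding T_def by (intro sum_nonneg mult_nonneg_nonneg nn) auto
    have T: "cmod (\<Sum>j\<le>m. of_nat (Suc (m - j)) * ode_coeff l n j) \<le> T"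
      unfolding T_def
      by (rule sum_norm_le) (use that in \<open>auto simp: norm_mult simp del: of_nat_Suc intro!: mult_left_mono\<close>)
    have "cmod (ode_coeff l n (Suc m)) = cmod l / 4 / (real (Suc m) * real (Suc m + n)) *
        cmod (\<Sum>j\<le>m. of_nat (Suc (m - j)) * ode_coeff l n j)"
      by (simp add: norm_mult norm_divide del: of_nat_Suc of_nat_add)
    also have "\<dots> \<le> cmod l / 4 / (real (Suc m) * real (Suc n)) * T"
      by (intro mult_mono divide_left_mono mult_left_mono T) auto
    also have "\<dots> = maj_coeff (cmod l / 4) (Suc m) / of_nat (Suc n)"
      by (simp add: T_def)
    finally show ?thesis .
  qed
  have all: "cmod (ode_coeff l n k) \<le> maj_coeff (cmod l / 4) k" for k
  proof (induction k rule: less_induct)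
    case (less k)
    show ?case
    proof (cases k)
      case (Suc m)
      have "cmod (ode_coeff l n (Suc m)) \<le> maj_coeff (cmod l / 4) (Suc m) / of_nat (Suc n)"
        by (rule step) (use less Suc in auto)
      also have "\<dots> \<le> maj_coeff (cmod l / 4) (Suc m)"
        using nn[of "Suc m"] by (simp add: divide_le_eq mult_le_cancel_left1 distrib_left del: maj_coeff.simps)
      finally show ?thesis using Suc by simp
    qed simp
  qed
  then show "cmod (ode_coeff l n k) \<le> maj_coeff (cmod l / 4) k" by blast
  show "k > 0 \<Longrightarrow> cmod (ode_coeff l n k) \<le> maj_coeff (cmod l / 4) k / of_nat (Suc n)"
    using step all by (cases k) auto
qed

text \<open>The sum of the majorant series at \<open>s\<close> for
  \<open>\<mu> = cmod l / 4\<close>. For \<open>0 \<le> s < 1\<close> it bounds every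
  \<open>G_n\<close> on \<open>cmod t \<le> s\<close>, whatever \<open>n\<close> is.\<close>

definition growth :: "complex \<Rightarrow> real \<Rightarrow> real" where
  "growth l s = exp (cmod l / 4 * s / (1 - s))"

lemma fps_conv_radius_ode: "fps_conv_radius (ode_fps l n) \<ge> 1"
  unfolding fps_conv_radius_def
proof (rule conv_radius_geI_ex')
  fix r :: real assume r: "0 < r" "ereal r < 1"
  have "summable (\<lambda>k. maj_coeff (cmod l / 4) k * r ^ k)"
    using maj_coeff_sums[of r "cmod l / 4"] r by (auto simp: sums_iff)
  then show "summable (\<lambda>k. fps_nth (ode_fps l n) k * of_real r ^ k)"
    by (rule summable_comparison_test'[where N = 0])
       (use r norm_ode_coeff_le(1) in \<open>auto simp: ode_fps_def norm_mult norm_power intro!: mult_right_mono\<close>)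
qed

lemma conv_ode: "cmod t < 1 \<Longrightarrow> ereal (cmod t) < fps_conv_radius (ode_fps l n)"
  by (rule less_le_trans[OF _ fps_conv_radius_ode]) auto

lemma conv_ode': "cmod t < 1 \<Longrightarrow> ereal (cmod t) < fps_conv_radius (fps_deriv (ode_fps l n))"
  by (rule less_le_trans[OF conv_ode fps_conv_radius_deriv])

lemma conv_ode'': "cmod t < 1 \<Longrightarrow> ereal (cmod t) < fps_conv_radius (fps_deriv (fps_deriv (ode_fps l n)))"
  by (rule less_le_trans[OF conv_ode' fps_conv_radius_deriv])

text \<open>Subtracting 1 removes the constant term, and every remaining coefficient carries the
  gain \<open>1 / (n + 1)\<close>; this is the locally uniform convergence of \<open>G_n\<close> to
  1.\<close>

lemma norm_eval_ode_minus_1_le: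
  assumes t: "cmod t \<le> s" and s: "s < 1"
  shows "cmod (eval_fps (ode_fps l n) t - 1) \<le> (growth l s - 1) / of_nat (Suc n)"
proof -
  have s0: "s \<ge> 0" using t norm_ge_zero[of t] by linarith
  have "(\<lambda>k. fps_nth (ode_fps l n) k * t ^ k) sums eval_fps (ode_fps l n) t"
    by (rule sums_eval_fps[OF conv_ode]) (use t s in auto)
  then have 1: "(\<lambda>k. ode_coeff l n (Suc k) * t ^ Suc k) sums (eval_fps (ode_fps l n) t - 1)"
    unfolding sums_Suc_iff[of "\<lambda>k. ode_coeff l n k * t ^ k"] by (simp add: ode_fps_def)
  have "(\<lambda>k. maj_coeff (cmod l / 4) k * s ^ k) sums growth l s"
    unfolding growth_def by (rule maj_coeff_sums[OF s0 s])
  then have "(\<lambda>k. maj_coeff (cmod l / 4) (Suc k) * s ^ Suc k) sums (growth l s - 1)"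
    unfolding sums_Suc_iff[of "\<lambda>k. maj_coeff (cmod l / 4) k * s ^ k"] by simp
  then have 2: "(\<lambda>k. maj_coeff (cmod l / 4) (Suc k) * s ^ Suc k / of_nat (Suc n)) sums ((growth l s - 1) / of_nat (Suc n))"
    by (rule sums_divide)
  have le: "cmod (ode_coeff l n (Suc k) * t ^ Suc k) \<le> maj_coeff (cmod l / 4) (Suc k) * s ^ Suc k / of_nat (Suc n)" for k
  proof -
    have "cmod (ode_coeff l n (Suc k)) * cmod t ^ Suc k \<le> maj_coeff (cmod l / 4) (Suc k) / of_nat (Suc n) * s ^ Suc k"
      using t order_trans[OF norm_ge_zero norm_ode_coeff_le(2)[of "Suc k" l n]]
      by (intro mult_mono norm_ode_coeff_le(2) power_mono) (simp_all del: maj_coeff.simps of_nat_Suc)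
    then show ?thesis by (simp add: norm_mult norm_power del: ode_coeff.simps maj_coeff.simps of_nat_Suc power_Suc)
  qed
  have "cmod (\<Sum>k. ode_coeff l n (Suc k) * t ^ Suc k) \<le> (\<Sum>k. maj_coeff (cmod l / 4) (Suc k) * s ^ Suc k / of_nat (Suc n))"
    by (rule norm_suminf_le[OF le sums_summable[OF 2]])
  then show ?thesis using sums_unique[OF 1] sums_unique[OF 2] by simp
qed

lemma growth_ge_1: "0 \<le> s \<Longrightarrow> s < 1 \<Longrightarrow> growth l s \<ge> 1"
  by (simp add: growth_def)

lemma norm_eval_ode_le:
  assumes t: "cmod t \<le> s" and s: "s < 1"
  shows "cmod (eval_fps (ode_fps l n) t) \<le> growth l s"
proof -
  have s0: "s \<ge> 0" using t norm_ge_zero[of t] by linarith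
  have "(growth l s - 1) / of_nat (Suc n) \<le> growth l s - 1"
    using growth_ge_1[OF s0 s, of l] by (simp add: divide_le_eq mult_le_cancel_left1 distrib_left)
  then have "cmod (eval_fps (ode_fps l n) t - 1) \<le> growth l s - 1"
    using norm_eval_ode_minus_1_le[OF t s, of l n] by linarith
  then show ?thesis using norm_triangle_ineq[of "eval_fps (ode_fps l n) t - 1" 1] by simp
qed

lemma eval_ode_equation:
  assumes t: "cmod t < 1"
  shows "4 * (1 - t)\<^sup>2 * (t * eval_fps (fps_deriv (fps_deriv (ode_fps l n))) t + of_nat (Suc n) * eval_fps (fps_deriv (ode_fps l n)) t)
     = l * eval_fps (ode_fps l n) t"
proof -
  let ?G = "ode_fps l n"
  have "fps_X * fps_deriv (fps_deriv ?G) + fps_const (of_nat (Suc n)) * fps_deriv ?G = fps_const (l / 4) * (?G * weight_fps)"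
  proof (rule fps_ext)
    fix k
    have "fps_nth (?G * weight_fps) k = (\<Sum>j\<le>k. of_nat (Suc (k - j)) * ode_coeff l n j)"
      unfolding fps_mult_nth atLeast0AtMost by (simp add: fps_nth_weight ode_fps_def mult.commute)
    moreover have "of_nat (Suc k) * of_nat (Suc k + n) * ode_coeff l n (Suc k) = l / 4 * (\<Sum>j\<le>k. of_nat (Suc (k - j)) * ode_coeff l n j)"
      by (simp add: field_simps del: of_nat_Suc of_nat_add)
    moreover have "fps_nth (fps_X * fps_deriv (fps_deriv ?G) + fps_const (of_nat (Suc n)) * fps_deriv ?G) k
        = of_nat (Suc k) * of_nat (Suc k + n) * ode_coeff l n (Suc k)"
      by (cases k) (simp_all add: ode_fps_def algebra_simps del: ode_coeff.simps)
    ultimately show "fps_nth (fps_X * fps_deriv (fps_deriv ?G) + fps_const (of_nat (Suc n)) * fps_deriv ?G) k =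
        fps_nth (fps_const (l / 4) * (?G * weight_fps)) k" by simp
  qed
  then have "eval_fps (fps_X * fps_deriv (fps_deriv ?G) + fps_const (of_nat (Suc n)) * fps_deriv ?G) t
     = eval_fps (fps_const (l / 4) * (?G * weight_fps)) t" by simp
  moreover have w: "ereal (cmod t) < fps_conv_radius weight_fps"
    by (rule less_le_trans[OF _ fps_conv_radius_weight]) (use t in auto)
  have "eval_fps (fps_X * fps_deriv (fps_deriv ?G) + fps_const (of_nat (Suc n)) * fps_deriv ?G) t =
     t * eval_fps (fps_deriv (fps_deriv ?G)) t + of_nat (Suc n) * eval_fps (fps_deriv ?G) t"
    using conv_ode'[OF t] conv_ode''[OF t]
    by (subst eval_fps_add)
       (auto simp: eval_fps_mult simp del: of_nat_Suc intro: less_le_trans[OF _ fps_conv_radius_mult])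
  moreover have "eval_fps (fps_const (l / 4) * (?G * weight_fps)) t = l / 4 * (eval_fps ?G t * (1 / (1 - t)\<^sup>2))"
    using conv_ode[OF t, of l n] w t
    by (subst eval_fps_mult)
       (auto simp: eval_fps_mult eval_fps_weight intro: less_le_trans[OF _ fps_conv_radius_mult])
  ultimately have "t * eval_fps (fps_deriv (fps_deriv ?G)) t + of_nat (Suc n) * eval_fps (fps_deriv ?G) t
     = l / 4 * (eval_fps ?G t * (1 / (1 - t)\<^sup>2))" by simp
  moreover have "(1 - t)\<^sup>2 \<noteq> 0" using t by auto
  ultimately show ?thesis by (simp del: of_nat_Suc)
qed

definition mode :: "complex \<Rightarrow> int \<Rightarrow> complex \<times> complex \<Rightarrow> complex" where
  "mode l n = (\<lambda>(z, w). (if n \<ge> 0 then z else w) ^ nat \<bar>n\<bar> * eval_fps (ode_fps l (nat \<bar>n\<bar>)) (z * w))"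

lemma bidisc_mult: "z \<in> disc \<Longrightarrow> w \<in> disc \<Longrightarrow> cmod (z * w) < 1"
  using mult_strict_mono[of "cmod z" 1 "cmod w" 1] by (simp add: norm_mult)

lemma holomorphic_on_eval_ode:
  "(\<lambda>z. z * c) ` A \<subseteq> ball 0 1 \<Longrightarrow> (\<lambda>z. eval_fps (ode_fps l n) (z * c)) holomorphic_on A"
  "(\<lambda>z. c * z) ` A \<subseteq> ball 0 1 \<Longrightarrow> (\<lambda>z. eval_fps (ode_fps l n) (c * z)) holomorphic_on A"
  using conv_ode
  by (auto intro!: holomorphic_on_compose_gen[of "\<lambda>z. z * c" A "eval_fps (ode_fps l n)" "ball 0 1", unfolded o_def]
      holomorphic_on_compose_gen[of "\<lambda>z. c * z" A "eval_fps (ode_fps l n)" "ball 0 1", unfolded o_def]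
      holomorphic_intros simp: eball_def)

lemma continuous_on_eval_fps_bidisc:
  "continuous_on bidisc (\<lambda>p. eval_fps (ode_fps l n) (fst p * snd p))"
  by (rule continuous_on_compose2[of "ball 0 1" "eval_fps (ode_fps l n)"])
     (use conv_ode in \<open>auto intro!: continuous_intros continuous_on_eval_fps bidisc_mult simp: eball_def\<close>)

text \<open>With \<open>m = nat \<bar>n\<bar>\<close>, the derivative by \<open>w\<close> and then
  by \<open>z\<close> is the monomial \<open>z^m\<close> or \<open>w^m\<close> times
  \<open>t G'' + (m + 1) G'\<close> at \<open>t = z w\<close>. The signs of \<open>n\<close> are
  separated because the monomial is met by different derivatives: by the second for
  \<open>n \<ge> 0\<close>, by the first for \<open>n < 0\<close>.\<close>

lemma eigen2_mode: "eigen2 l (mode l n)"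
  unfolding eigen2_def
proof (intro conjI ballI)
  define m where "m = nat \<bar>n\<bar>"
  define g where "g = eval_fps (ode_fps l m)"
  define g1 where "g1 = eval_fps (fps_deriv (ode_fps l m))"
  define g2 where "g2 = eval_fps (fps_deriv (fps_deriv (ode_fps l m)))"
  have gder: "(g has_field_derivative g1 t) (at t)" "(g1 has_field_derivative g2 t) (at t)" if "cmod t < 1" for t
    unfolding g_def g1_def g2_def
    by (rule has_field_derivative_eval_fps[OF conv_ode[OF that]] has_field_derivative_eval_fps[OF conv_ode'[OF that]])+
  have ode: "4 * (1 - t)\<^sup>2 * (t * g2 t + of_nat (Suc m) * g1 t) = l * g t" if "cmod t < 1" for t
    unfolding g_def g1_def g2_def by (rule eval_ode_equation[OF that])
  have mode: "mode l n = (\<lambda>(z, w). (if n \<ge> 0 then z else w) ^ m * g (z * w))"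
    by (simp add: mode_def m_def g_def)
  show "sep_holomorphic (mode l n)"
    unfolding sep_holomorphic_def
  proof (intro conjI ballI)
    show "continuous_on bidisc (mode l n)"
      unfolding mode_def case_prod_unfold
      by (cases "n \<ge> 0") (auto intro!: continuous_intros continuous_on_eval_fps_bidisc)
    show "(\<lambda>z. mode l n (z, w)) holomorphic_on disc" if "w \<in> disc" for w
      unfolding mode_def prod.case using that bidisc_mult
      by (cases "n \<ge> 0") (auto intro!: holomorphic_intros holomorphic_on_eval_ode)
    show "(\<lambda>w. mode l n (z, w)) holomorphic_on disc" if "z \<in> disc" for z
      unfolding mode_def prod.case using that bidisc_mult
      by (cases "n \<ge> 0") (auto intro!: holomorphic_intros holomorphic_on_eval_ode)
  qed
  fix p assume "p \<in> bidisc"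
  then obtain z w where p: "p = (z, w)" and zw: "z \<in> disc" "w \<in> disc" by auto
  have tw: "cmod (u * v) < 1" if "u \<in> disc" "v \<in> disc" for u v using that by (rule bidisc_mult)
  show "laplace_zw (mode l n) p = l * mode l n p"
  proof (cases "n \<ge> 0")
    case True
    have d2: "d2 (mode l n) q = (\<lambda>(u, v). u ^ Suc m * g1 (u * v)) q" if q': "q \<in> bidisc" for q
    proof -
      obtain u v where q: "q = (u, v)" "u \<in> disc" "v \<in> disc" using q' by auto
      have "((\<lambda>v. g (u * v)) has_field_derivative g1 (u * v) * u) (at v)"
        by (rule DERIV_chain'[of "\<lambda>v. u * v", OF _ gder(1)[OF tw[OF q(2,3)]]]) (auto intro!: derivative_eq_intros)
      from DERIV_cmult[OF this, of "u ^ m"]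
      show ?thesis unfolding d2_def mode q using True by (simp add: DERIV_imp_deriv mult_ac)
    qed
    have "d1 (d2 (mode l n)) p = d1 (\<lambda>(u, v). u ^ Suc m * g1 (u * v)) p"
      by (rule d1_cong[OF d2]) (use p zw in auto)
    also have "((\<lambda>u. u ^ Suc m * g1 (u * w)) has_field_derivative
        z ^ Suc m * (g2 (z * w) * w) + of_nat (Suc m) * z ^ m * g1 (z * w)) (at z)"
    proof (rule DERIV_mult')
      show "((\<lambda>u. g1 (u * w)) has_field_derivative g2 (z * w) * w) (at z)"
        by (rule DERIV_chain'[of "\<lambda>u. u * w", OF _ gder(2)[OF tw[OF zw]]]) (auto intro!: derivative_eq_intros)
      show "((\<lambda>u. u ^ Suc m) has_field_derivative of_nat (Suc m) * z ^ m) (at z)"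
        by (rule derivative_eq_intros refl)+ simp
    qed
    then have "d1 (\<lambda>(u, v). u ^ Suc m * g1 (u * v)) p = z ^ Suc m * (g2 (z * w) * w) + of_nat (Suc m) * z ^ m * g1 (z * w)"
      unfolding d1_def p prod.case by (rule DERIV_imp_deriv)
    finally have "laplace_zw (mode l n) p = z ^ m * (4 * (1 - z * w)\<^sup>2 * (z * w * g2 (z * w) + of_nat (Suc m) * g1 (z * w)))"
      unfolding p laplace_zw_eq by (simp add: algebra_simps)
    then show ?thesis using True by (simp only: ode[OF tw[OF zw]]) (simp add: p mode)
  next
    case False
    then have m0: "m > 0" by (simp add: m_def)
    have d2: "d2 (mode l n) q = (\<lambda>(u, v). v ^ m * (g1 (u * v) * u) + of_nat m * v ^ (m - 1) * g (u * v)) q" if q': "q \<in> bidisc" for q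
    proof -
      obtain u v where q: "q = (u, v)" "u \<in> disc" "v \<in> disc" using q' by auto
      have "((\<lambda>v. v ^ m * g (u * v)) has_field_derivative v ^ m * (g1 (u * v) * u) + of_nat m * v ^ (m - 1) * g (u * v)) (at v)"
      proof (rule DERIV_mult')
        show "((\<lambda>v. g (u * v)) has_field_derivative g1 (u * v) * u) (at v)"
          by (rule DERIV_chain'[of "\<lambda>v. u * v", OF _ gder(1)[OF tw[OF q(2,3)]]]) (auto intro!: derivative_eq_intros)
        show "((\<lambda>v. v ^ m) has_field_derivative of_nat m * v ^ (m - 1)) (at v)"
          by (auto intro!: derivative_eq_intros)
      qed
      then show ?thesis unfolding d2_def mode q using False by (simp add: DERIV_imp_deriv)
    qed
    have "d1 (d2 (mode l n)) p = d1 (\<lambda>(u, v). v ^ m * (g1 (u * v) * u) + of_nat m * v ^ (m - 1) * g (u * v)) p"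
      by (rule d1_cong[OF d2]) (use p zw in auto)
    also have "((\<lambda>u. w ^ m * (g1 (u * w) * u) + of_nat m * w ^ (m - 1) * g (u * w)) has_field_derivative
        w ^ m * (g1 (z * w) * 1 + g2 (z * w) * w * z) + of_nat m * w ^ (m - 1) * (g1 (z * w) * w)) (at z)"
    proof (intro DERIV_add DERIV_cmult DERIV_mult' DERIV_ident)
      show "((\<lambda>u. g (u * w)) has_field_derivative g1 (z * w) * w) (at z)"
        by (rule DERIV_chain'[of "\<lambda>u. u * w", OF _ gder(1)[OF tw[OF zw]]]) (auto intro!: derivative_eq_intros)
      show "((\<lambda>u. g1 (u * w)) has_field_derivative g2 (z * w) * w) (at z)"
        by (rule DERIV_chain'[of "\<lambda>u. u * w", OF _ gder(2)[OF tw[OF zw]]]) (auto intro!: derivative_eq_intros)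
    qed
    then have "d1 (\<lambda>(u, v). v ^ m * (g1 (u * v) * u) + of_nat m * v ^ (m - 1) * g (u * v)) p =
        w ^ m * (g1 (z * w) * 1 + g2 (z * w) * w * z) + of_nat m * w ^ (m - 1) * (g1 (z * w) * w)"
      unfolding d1_def p prod.case by (rule DERIV_imp_deriv)
    also have "\<dots> = w ^ m * (z * w * g2 (z * w) + of_nat (Suc m) * g1 (z * w))"
      using m0 by (cases m) (simp_all add: algebra_simps)
    finally have "laplace_zw (mode l n) p = w ^ m * (4 * (1 - z * w)\<^sup>2 * (z * w * g2 (z * w) + of_nat (Suc m) * g1 (z * w)))"
      unfolding p laplace_zw_eq by (simp add: algebra_simps)
    then show ?thesis using False by (simp only: ode[OF tw[OF zw]]) (simp add: p mode)
  qed
qed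

section \<open>Expansion into modes\<close>

lemma eigen_continuous_on: "eigen l f \<Longrightarrow> continuous_on disc f"
  unfolding eigen_def by (metis has_wirtinger_imp_continuous_on)

lemma fourier_bounded_near_0:
  assumes "continuous_on disc f"
  shows "\<exists>B. \<forall>r. 0 < r \<longrightarrow> r \<le> 1/2 \<longrightarrow> cmod (fourier f n r) \<le> B"
proof -
  have "compact (f ` cball 0 (1/2))"
    by (rule compact_continuous_image) (use assms in \<open>auto elim!: continuous_on_subset\<close>)
  then obtain B where B: "\<And>z. cmod z \<le> 1/2 \<Longrightarrow> cmod (f z) \<le> B"
    by (force dest!: compact_imp_bounded simp: bounded_iff)
  have "cmod (fourier f n r) \<le> 2 * pi * B" if "0 < r" "r \<le> 1/2" for r
    by (rule norm_fourier_le) (use that B in \<open>auto intro!: continuous_on_subset[OF assms]\<close>)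
  then show ?thesis by blast
qed

text \<open>Each application of \<open>fourier_has_vector_derivative\<close> offers two relations,
  and the angular one eliminates an unknown coefficient: that of \<open>P\<close> for
  \<open>f\<close>, that of \<open>S\<close> for \<open>Q\<close>. What is left closes up because
  the weight in the equation is constant on circles and can be taken out of the Fourier
  coefficient.\<close>

lemma eigen_radial_system:
  assumes "eigen l f"
  shows "\<exists>b B. radial_system l n (fourier f n) b \<and>
    (\<forall>r. 0 < r \<longrightarrow> r \<le> 1/2 \<longrightarrow> cmod (fourier f n r) \<le> B \<and> cmod (b r) \<le> B)"
proof -
  define R where "R z = l / (4 * (1 - of_real ((cmod z)\<^sup>2))\<^sup>2) * f z" for z
  obtain P Q S where P: "continuous_on disc P" and S: "continuous_on disc S"
    and fw: "\<And>z. z \<in> disc \<Longrightarrow> has_wirtinger f (P z) (Q z) z"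
    and Qw: "\<And>z. z \<in> disc \<Longrightarrow> has_wirtinger Q (R z) (S z) z"
    using assms unfolding eigen_def R_def by blast
  have f: "continuous_on disc f" by (rule has_wirtinger_imp_continuous_on[OF fw])
  have Q: "continuous_on disc Q" by (rule has_wirtinger_imp_continuous_on[OF Qw])
  have R: "continuous_on disc R"
    unfolding R_def[abs_def] using disc_weight_nonzero by (intro continuous_intros f) auto
  have "radial_system l n (fourier f n) (fourier Q (n + 1))"
    unfolding radial_system_def
  proof (intro ballI conjI)
    fix r :: real assume "r \<in> {0<..<1}"
    then have r: "0 < r" "r < 1" by auto
    have r0: "complex_of_real r \<noteq> 0" using r by simp
    note a = fourier_has_vector_derivative[OF fw P Q r, of n]
    note b = fourier_has_vector_derivative[OF Qw R S r, of "n + 1"]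
    have FR: "fourier R n r = l / (4 * (1 - of_real (r\<^sup>2))\<^sup>2) * fourier f n r"
      unfolding fourier_cmult[symmetric] by (rule fourier_cong) (use r in \<open>auto simp: R_def\<close>)
    have "fourier P (n - 1) r = of_int n / of_real r * fourier f n r + fourier Q (n + 1) r"
      using a(2) r0 by (simp add: field_simps)
    with a(1) show "(fourier f n has_vector_derivative
        (of_int n / of_real r * fourier f n r + 2 * fourier Q (n + 1) r)) (at r)"
      by (simp add: algebra_simps)
    have "fourier S (n + 1 + 1) r = fourier R n r - of_int (n + 1) / of_real r * fourier Q (n + 1) r"
      using b(2) r0 by (simp add: field_simps)
    moreover have "2 * fourier R n r = l / (2 * (1 - of_real (r\<^sup>2))\<^sup>2) * fourier f n r"
      by (simp add: FR)
    ultimately have "fourier R (n + 1 - 1) r + fourier S (n + 1 + 1) r =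
      l / (2 * (1 - of_real (r\<^sup>2))\<^sup>2) * fourier f n r - of_int (n + 1) / of_real r * fourier Q (n + 1) r"
      by (simp only: add_diff_cancel_right' mult_2[symmetric] add_diff_eq)
    with b(1) show "(fourier Q (n + 1) has_vector_derivative
        (l / (2 * (1 - of_real (r\<^sup>2))\<^sup>2) * fourier f n r - of_int (n + 1) / of_real r * fourier Q (n + 1) r)) (at r)"
      by simp
  qed
  moreover obtain B1 where "\<forall>r. 0 < r \<longrightarrow> r \<le> 1/2 \<longrightarrow> cmod (fourier f n r) \<le> B1"
    using fourier_bounded_near_0[OF f] by blast
  moreover obtain B2 where "\<forall>r. 0 < r \<longrightarrow> r \<le> 1/2 \<longrightarrow> cmod (fourier Q (n + 1) r) \<le> B2"
    using fourier_bounded_near_0[OF Q] by blast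
  ultimately show ?thesis
    by (intro exI[of _ "fourier Q (n + 1)"] exI[of _ "max B1 B2"]) (auto simp: le_max_iff_disj)
qed

lemma fourier_eigen_proportional:
  assumes f: "eigen l f" and g: "eigen l g" and \<rho>: "0 < \<rho>" "\<rho> < 1" "fourier g n \<rho> \<noteq> 0" and r: "0 < r" "r < 1"
  shows "fourier f n r = fourier f n \<rho> / fourier g n \<rho> * fourier g n r"
proof -
  obtain b B where b: "radial_system l n (fourier f n) b"
    "\<And>r. 0 < r \<Longrightarrow> r \<le> 1/2 \<Longrightarrow> cmod (fourier f n r) \<le> B \<and> cmod (b r) \<le> B"
    using eigen_radial_system[OF f, of n] by blast
  obtain c C where c: "radial_system l n (fourier g n) c"
    "\<And>r. 0 < r \<Longrightarrow> r \<le> 1/2 \<Longrightarrow> cmod (fourier g n r) \<le> C \<and> cmod (c r) \<le> C"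
    using eigen_radial_system[OF g, of n] by blast
  show ?thesis
    by (rule radial_system_proportional[OF b(1) c(1) _ \<rho> r, of "max B C"])
       (use b(2) c(2) in \<open>auto simp: le_max_iff_disj\<close>)
qed

lemma integral_cis: "integral {0..2*pi} (\<lambda>t. cis (of_int k * t)) = (if k = 0 then 2 * of_real pi else 0)"
proof (cases "k = 0")
  case False
  have "((\<lambda>t. cis (of_int k * t)) has_integral
     cis (of_int k * (2*pi)) / (\<i> * of_int k) - cis (of_int k * 0) / (\<i> * of_int k)) {0..2*pi}"
  proof (rule fundamental_theorem_of_calculus)
    fix t :: real
    show "((\<lambda>t. cis (of_int k * t) / (\<i> * of_int k)) has_vector_derivative cis (of_int k * t)) (at t within {0..2*pi})"
      using has_vector_derivative_divide[OF has_vector_derivative_cis[of "of_int k" t "{0..2*pi}"], of "\<i> * of_int k"] False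
      by simp
  qed simp
  moreover have "cis (of_int k * (2*pi)) = 1"
    using cis_multiple_2pi[of "of_int k"] by (simp add: mult_ac)
  ultimately show ?thesis using False by (simp add: integral_unique)
qed (simp add: scaleR_conv_of_real)

definition amplitude :: "complex \<Rightarrow> int \<Rightarrow> real \<Rightarrow> complex" where
  "amplitude l n r = of_real r ^ nat \<bar>n\<bar> * eval_fps (ode_fps l (nat \<bar>n\<bar>)) (of_real (r\<^sup>2))"

lemma mode_circle: "mode l n (rcis r t, cnj (rcis r t)) = amplitude l n r * cis (of_int n * t)"
proof -
  have "rcis r t * cnj (rcis r t) = of_real (r\<^sup>2)"
    by (simp only: complex_norm_square[symmetric] complex_mod_rcis power2_abs)
  moreover have "(if n \<ge> 0 then rcis r t else cnj (rcis r t)) ^ nat \<bar>n\<bar> = of_real r ^ nat \<bar>n\<bar> * cis (of_int n * t)"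
  proof (cases "n \<ge> 0")
    case True
    then have "cis t ^ nat n = cis (of_int n * t)" by (simp only: Complex.DeMoivre of_nat_nat)
    then show ?thesis using True by (simp add: rcis_def power_mult_distrib)
  next
    case False
    then have "cis (- t) ^ nat (- n) = cis (of_int n * t)" by (simp only: Complex.DeMoivre) simp
    then show ?thesis using False by (simp add: rcis_def power_mult_distrib cis_cnj)
  qed
  ultimately show ?thesis unfolding mode_def amplitude_def prod.case by (simp add: mult_ac)
qed

lemma fourier_mode:
  "fourier (\<lambda>z. mode l n (z, cnj z)) k r = (if k = n then 2 * of_real pi * amplitude l n r else 0)"
proof -
  have "fourier (\<lambda>z. mode l n (z, cnj z)) k r = integral {0..2*pi} (\<lambda>t. amplitude l n r * cis (of_int (n - k) * t))"
    unfolding fourier_def mode_circle by (simp add: mult.assoc cis_mult algebra_simps)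
  also have "\<dots> = amplitude l n r * integral {0..2*pi} (\<lambda>t. cis (of_int (n - k) * t))"
    by (rule integral_mult_right)
  finally show ?thesis unfolding integral_cis by auto
qed

lemma eigen_cong:
  assumes "\<And>z. z \<in> disc \<Longrightarrow> f z = g z" "eigen l f"
  shows "eigen l g"
proof -
  obtain P Q S where PQS: "continuous_on disc P" "continuous_on disc S"
     "\<And>z. z \<in> disc \<Longrightarrow> has_wirtinger f (P z) (Q z) z"
     "\<And>z. z \<in> disc \<Longrightarrow> has_wirtinger Q (l / (4 * (1 - of_real ((cmod z)\<^sup>2))\<^sup>2) * f z) (S z) z"
    using assms(2) unfolding eigen_def by blast
  have "has_wirtinger g (P z) (Q z) z" if "z \<in> disc" for z
    by (rule has_wirtinger_cong[OF PQS(3)[OF that], of disc]) (use that assms in auto)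
  then show ?thesis unfolding eigen_def using PQS assms(1) by metis
qed

lemma eigen2_imp_eigen:
  assumes "eigen2 l F"
  shows "eigen l (\<lambda>z. F (z, cnj z))"
  by (rule eigen_cong[OF _ X_disc_imp_eigen[OF eigen2_imp_X_disc[OF assms]]]) simp

section \<open>Lower bounds for amplitudes and upper bounds for coefficients\<close>

lemma norm_amplitude_ge:
  assumes "cmod (eval_fps (ode_fps l (nat \<bar>n\<bar>)) (of_real (r\<^sup>2))) \<ge> 1/2" "r \<ge> 0"
  shows "cmod (amplitude l n r) \<ge> r ^ nat \<bar>n\<bar> / 2"
  using mult_left_mono[OF assms(1), of "r ^ nat \<bar>n\<bar>"] assms(2) by (simp add: amplitude_def norm_mult norm_power)

text \<open>As \<open>growth l s\<close> tends to 1 for small \<open>s\<close>, uniformly in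
  \<open>n\<close> by its very form, one radius keeps all \<open>G_n\<close> within 1/2 of 1; the
  threshold 3/2 is chosen for this.\<close>

lemma amplitude_nonzero_small:
  assumes "R > 0"
  shows "\<exists>\<rho>. 0 < \<rho> \<and> \<rho> < R \<and> \<rho> < 1 \<and> (\<forall>n. cmod (amplitude l n \<rho>) \<ge> \<rho> ^ nat \<bar>n\<bar> / 2)"
proof -
  have "(growth l \<longlongrightarrow> growth l 0) (at_right 0)"
    unfolding growth_def[abs_def] by (auto intro!: tendsto_eq_intros)
  then have "\<forall>\<^sub>F s in at_right 0. growth l s < 3/2"
    by (rule order_tendstoD) (simp add: growth_def)
  moreover have "\<forall>\<^sub>F s in at_right 0. (s::real) \<in> {0<..<min 1 (R\<^sup>2)}"
    by (rule eventually_at_right_real) (use assms in auto)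
  ultimately have "\<forall>\<^sub>F s in at_right 0. growth l s < 3/2 \<and> s \<in> {0<..<min 1 (R\<^sup>2)}"
    by (rule eventually_conj)
  then obtain s where s: "growth l s < 3/2" "0 < s" "s < 1" "s < R\<^sup>2"
    using eventually_happens[of _ "at_right (0::real)"] trivial_limit_at_right_real by fastforce
  define \<rho> where "\<rho> = sqrt s"
  have \<rho>: "0 < \<rho>" "\<rho> < R" "\<rho> < 1" "\<rho>\<^sup>2 = s"
    using s assms by (auto simp: \<rho>_def real_sqrt_less_iff intro: real_less_lsqrt)
  have "cmod (eval_fps (ode_fps l m) (of_real (\<rho>\<^sup>2))) \<ge> 1/2" for m
  proof -
    have "cmod (eval_fps (ode_fps l m) (of_real (\<rho>\<^sup>2)) - 1) \<le> (growth l s - 1) / of_nat (Suc m)"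
      by (rule norm_eval_ode_minus_1_le) (use \<rho> s in auto)
    also have "\<dots> \<le> growth l s - 1"
      using growth_ge_1[of s l] s by (simp add: divide_le_eq mult_le_cancel_left1 distrib_left)
    also have "\<dots> \<le> 1/2" using s by simp
    finally show ?thesis
      using norm_triangle_ineq2[of 1 "1 - eval_fps (ode_fps l m) (of_real (\<rho>\<^sup>2))"]
      by (simp add: norm_minus_commute)
  qed
  then show ?thesis using \<rho> norm_amplitude_ge[of l _ \<rho>] by (intro exI[of _ \<rho>]) auto
qed

text \<open>At a prescribed radius the gain \<open>1 / (n + 1)\<close> brings \<open>G_n\<close>
  within 1/2 of 1 for large \<open>n\<close>; for small \<open>n\<close> the amplitude may be 0
  here.\<close>

lemma amplitude_nonzero_large:
  assumes R: "0 < R" "R < 1"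
  shows "\<exists>N. \<forall>n. nat \<bar>n\<bar> \<ge> N \<longrightarrow> cmod (amplitude l n R) \<ge> R ^ nat \<bar>n\<bar> / 2"
proof -
  have R2: "R\<^sup>2 < 1" using R by (simp add: power_less_one_iff)
  obtain N where N: "2 * (growth l (R\<^sup>2) - 1) \<le> real N" using real_arch_simple by blast
  have "cmod (amplitude l n R) \<ge> R ^ nat \<bar>n\<bar> / 2" if n: "nat \<bar>n\<bar> \<ge> N" for n
  proof -
    define m where "m = nat \<bar>n\<bar>"
    have "cmod (eval_fps (ode_fps l m) (of_real (R\<^sup>2)) - 1) \<le> (growth l (R\<^sup>2) - 1) / of_nat (Suc m)"
      by (rule norm_eval_ode_minus_1_le) (use R R2 in \<open>auto simp: norm_power\<close>)
    also have "\<dots> \<le> 1/2" using N n by (simp add: m_def[symmetric] divide_le_eq)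
    finally have "cmod (eval_fps (ode_fps l m) (of_real (R\<^sup>2))) \<ge> 1/2"
      using norm_triangle_ineq2[of 1 "1 - eval_fps (ode_fps l m) (of_real (R\<^sup>2))"]
      by (simp add: norm_minus_commute)
    then show ?thesis unfolding m_def by (rule norm_amplitude_ge) (use R in simp)
  qed
  then show ?thesis by blast
qed

text \<open>The point is that \<open>c n\<close> does not depend on \<open>r\<close>. The factor
  \<open>2 * pi\<close> appears because \<open>fourier\<close> is not normalised.\<close>

definition expansion_coeffs :: "complex \<Rightarrow> (complex \<Rightarrow> complex) \<Rightarrow> (int \<Rightarrow> complex) \<Rightarrow> bool" where
  "expansion_coeffs l f c \<longleftrightarrow>
     (\<forall>n r. 0 < r \<longrightarrow> r < 1 \<longrightarrow> fourier f n r = c n * (2 * of_real pi * amplitude l n r))"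

lemma expansion_coeffs_exist:
  assumes f: "eigen l f"
  shows "\<exists>c. expansion_coeffs l f c"
proof -
  \<comment> \<open>One radius at which no amplitude vanishes, so that all \<open>c n\<close> can be
    defined as quotients there; proportionality carries the relation to every other radius.\<close>
  obtain \<rho> where \<rho>: "0 < \<rho>" "\<rho> < 1" "\<And>n. cmod (amplitude l n \<rho>) \<ge> \<rho> ^ nat \<bar>n\<bar> / 2"
    using amplitude_nonzero_small[of 1 l] by auto
  have nz: "amplitude l n \<rho> \<noteq> 0" for n using \<rho>(3)[of n] zero_less_power[OF \<rho>(1), of "nat \<bar>n\<bar>"] by auto
  have "fourier f n r = fourier f n \<rho> / (2 * of_real pi * amplitude l n \<rho>) * (2 * of_real pi * amplitude l n r)"
    if "0 < r" "r < 1" for n r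
    using fourier_eigen_proportional[OF f eigen2_imp_eigen[OF eigen2_mode[of l n]] \<rho>(1,2) _ that, of n] nz
    by (simp add: fourier_mode)
  then show ?thesis
    unfolding expansion_coeffs_def
    by (intro exI[of _ "\<lambda>n. fourier f n \<rho> / (2 * of_real pi * amplitude l n \<rho>)"]) simp
qed

lemma expansion_coeff_le:
  assumes f: "continuous_on disc f" and c: "expansion_coeffs l f c" and r: "0 < r" "r < 1"
    and amp: "cmod (amplitude l n r) \<ge> r ^ nat \<bar>n\<bar> / 2" and M: "\<And>z. cmod z \<le> r \<Longrightarrow> cmod (f z) \<le> M"
  shows "cmod (c n) \<le> 2 * M / r ^ nat \<bar>n\<bar>"
proof -
  have "cmod (fourier f n r) \<le> 2 * pi * M"
    by (rule norm_fourier_le) (use r M in \<open>auto intro!: continuous_on_subset[OF f]\<close>)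
  moreover have "fourier f n r = c n * (2 * of_real pi * amplitude l n r)"
    using c r by (simp add: expansion_coeffs_def)
  ultimately have "cmod (c n) * cmod (amplitude l n r) \<le> M"
    by (simp add: norm_mult mult.left_commute[of _ pi] mult.left_commute[of _ 2])
  moreover have "cmod (c n) * (r ^ nat \<bar>n\<bar> / 2) \<le> cmod (c n) * cmod (amplitude l n r)"
    by (intro mult_left_mono amp) simp
  ultimately show ?thesis using r by (simp add: field_simps)
qed

text \<open>The indices with \<open>nat \<bar>n\<bar> \<ge> N\<close> are estimated at
  \<open>R\<close> itself, the others at the smaller \<open>\<rho>\<close>, which costs at most
  \<open>(R / \<rho>)^N\<close>. The order of quantifiers matters: \<open>K\<close> is fixed before
  \<open>f\<close>.\<close>

lemma expansion_coeffs_bound: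
  assumes R: "0 < R" "R < 1"
  shows "\<exists>K\<ge>0. \<forall>f c M n. continuous_on disc f \<longrightarrow> expansion_coeffs l f c \<longrightarrow>
    (\<forall>z. cmod z \<le> R \<longrightarrow> cmod (f z) \<le> M) \<longrightarrow> cmod (c n) \<le> K * M / R ^ nat \<bar>n\<bar>"
proof -
  obtain \<rho> where \<rho>: "0 < \<rho>" "\<rho> < R" "\<And>n. cmod (amplitude l n \<rho>) \<ge> \<rho> ^ nat \<bar>n\<bar> / 2"
    using amplitude_nonzero_small[OF R(1), of l] by auto
  obtain N where N: "\<And>n. nat \<bar>n\<bar> \<ge> N \<Longrightarrow> cmod (amplitude l n R) \<ge> R ^ nat \<bar>n\<bar> / 2"
    using amplitude_nonzero_large[OF R, of l] by blast
  define q where "q = R / \<rho>"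
  have q: "q \<ge> 1" using \<rho> by (simp add: q_def)
  have "cmod (c n) \<le> 2 * q ^ N * M / R ^ nat \<bar>n\<bar>"
    if f: "continuous_on disc f" and c: "expansion_coeffs l f c" and M: "\<And>z. cmod z \<le> R \<Longrightarrow> cmod (f z) \<le> M" for f c M n
  proof -
    have M0: "M \<ge> 0" using order_trans[OF norm_ge_zero M[of 0]] R by simp
    show ?thesis
    proof (cases "nat \<bar>n\<bar> \<ge> N")
      case True
      have "cmod (c n) \<le> 2 * M / R ^ nat \<bar>n\<bar>" by (rule expansion_coeff_le[OF f c R N[OF True] M])
      also have "\<dots> \<le> 2 * q ^ N * M / R ^ nat \<bar>n\<bar>"
        using R M0 one_le_power[OF q, of N] mult_left_mono[of 1 "q ^ N" M] by (intro divide_right_mono) (auto simp: mult.commute)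
      finally show ?thesis .
    next
      case False
      have "cmod (c n) \<le> 2 * M / \<rho> ^ nat \<bar>n\<bar>"
        by (rule expansion_coeff_le[OF f c \<rho>(1) _ \<rho>(3)]) (use R \<rho> M in auto)
      also have "\<dots> = 2 * M * q ^ nat \<bar>n\<bar> / R ^ nat \<bar>n\<bar>"
        using R by (simp add: q_def power_divide)
      also have "\<dots> \<le> 2 * M * q ^ N / R ^ nat \<bar>n\<bar>"
        using R M0 False by (intro divide_right_mono mult_left_mono power_increasing q) auto
      finally show ?thesis by (simp add: mult_ac)
    qed
  qed
  moreover have "2 * q ^ N \<ge> 0" using q by simp
  ultimately show ?thesis by blast
qed

text \<open>Pairing \<open>k\<close> with \<open>- k - 1\<close> enumerates every integer exactly once.\<close>

definition paired_mode :: "complex \<Rightarrow> (int \<Rightarrow> complex) \<Rightarrow> nat \<Rightarrow> complex \<times> complex \<Rightarrow> complex" where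
  "paired_mode l c k p = c (int k) * mode l (int k) p + c (- int k - 1) * mode l (- int k - 1) p"

lemma norm_mode_le:
  assumes r: "0 \<le> r" "r < 1" and p: "p \<in> cball 0 r \<times> cball 0 r"
  shows "cmod (mode l n p) \<le> r ^ nat \<bar>n\<bar> * growth l (r\<^sup>2)"
proof -
  obtain z w where p: "p = (z, w)" "cmod z \<le> r" "cmod w \<le> r" using p by auto
  have "cmod (z * w) \<le> r\<^sup>2" unfolding norm_mult power2_eq_square by (intro mult_mono p r) auto
  moreover have "r\<^sup>2 < 1" using r by (simp add: power_less_one_iff)
  ultimately have "cmod (eval_fps (ode_fps l (nat \<bar>n\<bar>)) (z * w)) \<le> growth l (r\<^sup>2)" by (rule norm_eval_ode_le)
  then show ?thesis
    unfolding mode_def p prod.case norm_mult norm_power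
    by (intro mult_mono power_mono) (use p r in auto)
qed

text \<open>On the closed bidisc of radius \<open>r\<close> a mode has size at most a constant times
  \<open>r^\<bar>n\<bar>\<close>, against \<open>R^(-\<bar>n\<bar>)\<close> for its coefficient; any
  \<open>R\<close> strictly between \<open>r\<close> and 1 gives a geometric majorant, and the
  midpoint is taken.\<close>

lemma paired_mode_bound:
  assumes r: "0 < r" "r < 1"
  shows "\<exists>C\<ge>0. \<exists>R>r. R < 1 \<and> (\<forall>f c M k p. continuous_on disc f \<longrightarrow> expansion_coeffs l f c \<longrightarrow>
    (\<forall>z. cmod z \<le> R \<longrightarrow> cmod (f z) \<le> M) \<longrightarrow> p \<in> cball 0 r \<times> cball 0 r \<longrightarrow>
    cmod (paired_mode l c k p) \<le> C * M * (r / R) ^ k)"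
proof -
  define R where "R = (r + 1) / 2"
  have R: "0 < R" "r < R" "R < 1" using r by (auto simp: R_def)
  obtain K where K: "K \<ge> 0" "\<And>f c M n. continuous_on disc f \<Longrightarrow> expansion_coeffs l f c \<Longrightarrow>
    (\<And>z. cmod z \<le> R \<Longrightarrow> cmod (f z) \<le> M) \<Longrightarrow> cmod (c n) \<le> K * M / R ^ nat \<bar>n\<bar>"
    using expansion_coeffs_bound[OF R(1,3), of l] by blast
  define g where "g = growth l (r\<^sup>2)"
  have g: "g \<ge> 0" by (simp add: g_def growth_def)
  have "cmod (paired_mode l c k p) \<le> 2 * K * g * M * (r / R) ^ k"
    if f: "continuous_on disc f" "expansion_coeffs l f c" and M: "\<And>z. cmod z \<le> R \<Longrightarrow> cmod (f z) \<le> M"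
      and p: "p \<in> cball 0 r \<times> cball 0 r" for f c M k p
  proof -
    have M0: "M \<ge> 0" using order_trans[OF norm_ge_zero M[of 0]] R by simp
    \<comment> \<open>Both indices \<open>k\<close> and \<open>- k - 1\<close> have absolute value
      at least \<open>k\<close>, and \<open>r / R < 1\<close>.\<close>
    have summand: "cmod (c n * mode l n p) \<le> K * M * g * (r / R) ^ k" if n: "nat \<bar>n\<bar> \<ge> k" for n
    proof -
      have "cmod (c n * mode l n p) \<le> (K * M / R ^ nat \<bar>n\<bar>) * (r ^ nat \<bar>n\<bar> * g)"
        unfolding norm_mult g_def using r R K(1) M0
        by (intro mult_mono K(2)[OF f M] norm_mode_le p) auto
      also have "\<dots> = K * M * g * (r / R) ^ nat \<bar>n\<bar>" by (simp add: power_divide)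
      also have "\<dots> \<le> K * M * g * (r / R) ^ k"
        using r R K(1) M0 g n by (intro mult_left_mono power_decreasing) auto
      finally show ?thesis .
    qed
    show ?thesis
      unfolding paired_mode_def
      using norm_triangle_le[OF add_mono[OF summand[of "int k"] summand[of "- int k - 1"]]] by (simp add: mult_ac)
  qed
  moreover have "2 * K * g \<ge> 0" using K g by simp
  ultimately show ?thesis using R by blast
qed

lemma fourier_uniform_limit:
  assumes lim: "uniform_limit (sphere 0 r) u F sequentially" and r: "r \<ge> 0"
    and u: "\<And>N. continuous_on (sphere 0 r) (u N)"
  shows "(\<lambda>N. fourier (u N) n r) \<longlonglongrightarrow> fourier F n r"
proof (rule LIMSEQ_I)
  fix e :: real assume e: "e > 0"
  have F: "continuous_on (sphere 0 r) F"
    by (rule uniform_limit_theorem[OF _ lim]) (use u in auto)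
  define d where "d = e / (4 * pi)"
  have d: "d > 0" using e by (simp add: d_def)
  obtain N0 where N0: "\<And>N z. N \<ge> N0 \<Longrightarrow> z \<in> sphere 0 r \<Longrightarrow> dist (u N z) (F z) < d"
    using uniform_limitD[OF lim d] unfolding eventually_sequentially by blast
  have "norm (fourier (u N) n r - fourier F n r) < e" if "N \<ge> N0" for N
  proof -
    have "fourier (u N) n r - fourier F n r = fourier (\<lambda>z. u N z + (-1) * F z) n r"
      using fourier_add[OF u continuous_on_mult_left[OF F, of "-1"] r, of N n] fourier_cmult[of "-1" F n r] by simp
    moreover have "cmod (fourier (\<lambda>z. u N z + (-1) * F z) n r) \<le> 2 * pi * d"
      by (rule norm_fourier_le)
         (use N0[OF that] r in \<open>auto intro!: continuous_intros u F less_imp_le simp: dist_norm\<close>)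
    ultimately show ?thesis using e by (simp add: d_def)
  qed
  then show "\<exists>no. \<forall>N\<ge>no. norm (fourier (u N) n r - fourier F n r) < e" by blast
qed

lemma eigen2_paired_mode: "eigen2 l (paired_mode l c k)"
  unfolding paired_mode_def[abs_def] by (intro eigen2_linear eigen2_mode)

lemma fourier_paired_mode:
  assumes r: "0 \<le> r" "r < 1"
  shows "fourier (\<lambda>z. paired_mode l c k (z, cnj z)) n r =
    (if k = (if n \<ge> 0 then nat n else nat (- n - 1)) then c n * (2 * of_real pi * amplitude l n r) else 0)"
proof -
  have cont: "continuous_on (sphere 0 r) (\<lambda>z. mode l m (z, cnj z))" for m
    using continuous_on_restriction[of "mode l m"] eigen2_mode[of l m] r
    by (auto simp: eigen2_def elim!: continuous_on_subset)
  have "fourier (\<lambda>z. paired_mode l c k (z, cnj z)) n r =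
     c (int k) * fourier (\<lambda>z. mode l (int k) (z, cnj z)) n r + c (- int k - 1) * fourier (\<lambda>z. mode l (- int k - 1) (z, cnj z)) n r"
    unfolding paired_mode_def by (subst fourier_add) (auto intro!: continuous_intros cont r simp: fourier_cmult)
  then show ?thesis unfolding fourier_mode by auto
qed

text \<open>The M-test gives uniform convergence on smaller closed bidiscs, so the sum inherits the
  equation. On each circle about 0 Fourier coefficients pass to the limit, and those of the
  restriction of \<open>F\<close> agree with those of \<open>f\<close>; a continuous function is
  determined by them.\<close>

lemma eigen_extension:
  assumes f: "eigen l f" and c: "expansion_coeffs l f c"
  defines "F \<equiv> (\<lambda>p. \<Sum>k. paired_mode l c k p)"
  shows "eigen2 l F" and "\<And>z. z \<in> disc \<Longrightarrow> F (z, cnj z) = f z"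
proof -
  have fc: "continuous_on disc f" by (rule eigen_continuous_on[OF f])
  have ulim0: "uniform_limit (cball 0 r \<times> cball 0 r) (\<lambda>N p. \<Sum>k<N. paired_mode l c k p) F sequentially" if r: "0 < r" "r < 1" for r
  proof -
    obtain C R where CR: "R > r" "R < 1" "\<And>f c M k p. continuous_on disc f \<Longrightarrow> expansion_coeffs l f c \<Longrightarrow>
      (\<And>z. cmod z \<le> R \<Longrightarrow> cmod (f z) \<le> M) \<Longrightarrow> p \<in> cball 0 r \<times> cball 0 r \<Longrightarrow>
      cmod (paired_mode l c k p) \<le> C * M * (r / R) ^ k"
      using paired_mode_bound[OF r, of l] by blast
    have "compact (f ` cball 0 R)"
      by (rule compact_continuous_image) (use CR fc in \<open>auto elim!: continuous_on_subset\<close>)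
    then obtain M where M: "\<And>z. cmod z \<le> R \<Longrightarrow> cmod (f z) \<le> M"
      by (force dest!: compact_imp_bounded simp: bounded_iff)
    show ?thesis
      unfolding F_def
    proof (rule Weierstrass_m_test)
      show "cmod (paired_mode l c k p) \<le> C * M * (r / R) ^ k" if "p \<in> cball 0 r \<times> cball 0 r" for k p
        by (rule CR(3)[OF fc c M that])
      show "summable (\<lambda>k. C * M * (r / R) ^ k)"
        using r CR by (intro summable_mult summable_geometric) auto
    qed
  qed
  have ulim: "uniform_limit (cball 0 r \<times> cball 0 r) (\<lambda>N p. \<Sum>k<N. paired_mode l c k p) F sequentially" if "r < 1" for r
    by (rule uniform_limit_on_subset[OF ulim0[of "max r (1/2)"]]) (use that in auto)
  have S: "eigen2 l (\<lambda>p. \<Sum>k<N. paired_mode l c k p)" for N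
    by (rule eigen2_sum[OF eigen2_paired_mode])
  show F: "eigen2 l F" by (rule eigen2_uniform_limit[OF S ulim])
  have Fc: "continuous_on disc (\<lambda>z. F (z, cnj z))"
    by (rule continuous_on_restriction) (use F in \<open>simp add: eigen2_def\<close>)
  have eq: "F (z, cnj z) = f z" if z: "z \<in> disc" "z \<noteq> 0" for z
  proof -
    define r where "r = cmod z"
    have r: "0 < r" "r < 1" using z by (auto simp: r_def)
    have sub: "sphere 0 r \<subseteq> disc" using r by auto
    define h where "h z = f z + (-1) * F (z, cnj z)" for z
    have "h z = 0"
    proof (rule fourier_eq_0_imp_eq_0[of r h])
      show "continuous_on (sphere 0 r) h"
        unfolding h_def[abs_def] by (intro continuous_intros continuous_on_subset[OF fc sub] continuous_on_subset[OF Fc sub])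
      fix n
      \<comment> \<open>The pair that contains the index \<open>n\<close>; all other pairs
        contribute 0 to the \<open>n\<close>-th Fourier coefficient.\<close>
      define k0 where "k0 = (if n \<ge> 0 then nat n else nat (- n - 1))"
      have u: "uniform_limit (sphere 0 r) (\<lambda>N z. \<Sum>k<N. paired_mode l c k (z, cnj z)) (\<lambda>z. F (z, cnj z)) sequentially"
      proof (rule uniform_limitI)
        fix e :: real assume "e > 0"
        from uniform_limitD[OF ulim[OF r(2)] this]
        show "\<forall>\<^sub>F N in sequentially. \<forall>z\<in>sphere 0 r. dist (\<Sum>k<N. paired_mode l c k (z, cnj z)) (F (z, cnj z)) < e"
          by eventually_elim auto
      qed
      have pc: "continuous_on (sphere 0 r) (\<lambda>z. paired_mode l c k (z, cnj z))" for k
        using eigen2_paired_mode[of l c k] unfolding eigen2_def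
        by (intro continuous_on_subset[OF continuous_on_restriction sub]) blast
      have fs: "fourier (\<lambda>z. \<Sum>k<N. paired_mode l c k (z, cnj z)) n r = (\<Sum>k<N. fourier (\<lambda>z. paired_mode l c k (z, cnj z)) n r)" for N
      proof (induction N)
        case 0
        show ?case by (simp add: fourier_def)
      next
        case (Suc N)
        then show ?case using r by (simp add: fourier_add continuous_on_sum pc)
      qed
      have "(\<lambda>k. fourier (\<lambda>z. paired_mode l c k (z, cnj z)) n r) sums fourier (\<lambda>z. F (z, cnj z)) n r"
        unfolding sums_def fs[symmetric]
        by (rule fourier_uniform_limit[OF u]) (use r in \<open>auto intro!: continuous_on_sum pc\<close>)
      moreover have "(\<lambda>k. fourier (\<lambda>z. paired_mode l c k (z, cnj z)) n r) sums (c n * (2 * of_real pi * amplitude l n r))"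
        using r sums_single[of k0 "\<lambda>_. c n * (2 * of_real pi * amplitude l n r)"]
        by (simp add: fourier_paired_mode k0_def)
      ultimately have "fourier (\<lambda>z. F (z, cnj z)) n r = fourier f n r"
        using c r sums_unique2 unfolding expansion_coeffs_def by fastforce
      then show "fourier h n r = 0"
        unfolding h_def[abs_def]
        using fourier_add[OF continuous_on_subset[OF fc sub]
            continuous_on_mult_left[OF continuous_on_subset[OF Fc sub], of "-1"], of n]
          fourier_cmult[of "-1" "\<lambda>z. F (z, cnj z)" n r] r by simp
    qed (use r in \<open>auto simp: r_def\<close>)
    then show ?thesis by (simp add: h_def)
  qed
  \<comment> \<open>\<open>expansion_coeffs\<close> speaks of positive radii only, so the origin is
    reached by continuity.\<close>
  have "F (0, cnj 0) = f 0"
  proof (rule tendsto_unique[of "at 0"])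
    have "isCont (\<lambda>z. F (z, cnj z)) 0" "isCont f 0"
      using Fc fc by (auto simp: continuous_on_eq_continuous_at)
    then show "((\<lambda>z. F (z, cnj z)) \<longlongrightarrow> F (0, cnj 0)) (at 0)"
      by (simp add: isCont_def)
    have f0: "(f \<longlongrightarrow> f 0) (at 0)" using \<open>isCont f 0\<close> by (simp add: isCont_def)
    have "\<forall>\<^sub>F z in at 0. z \<in> disc - {0}" by (rule eventually_at_in_open) auto
    then have "\<forall>\<^sub>F z in at 0. f z = F (z, cnj z)" by eventually_elim (use eq in auto)
    then show "((\<lambda>z. F (z, cnj z)) \<longlongrightarrow> f 0) (at 0)"
      by (rule Lim_transform_eventually[OF f0])
  qed auto
  with eq show "F (z, cnj z) = f z" if "z \<in> disc" for z using that by (cases "z = 0") auto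
qed

section \<open>The extension map: uniqueness, linearity, bijectivity, continuity\<close>

lemma X_bidisc_unique:
  assumes "F \<in> X_bidisc l" "G \<in> X_bidisc l" "\<And>z. z \<in> disc \<Longrightarrow> F (z, cnj z) = G (z, cnj z)"
  shows "F = G"
proof (rule extensionalityI)
  show "F \<in> extensional bidisc" "G \<in> extensional bidisc" using assms by (auto simp: X_bidisc_iff)
  fix p assume p: "p \<in> bidisc"
  have "sep_holomorphic (\<lambda>p. 1 * F p + (-1) * G p)"
    by (rule sep_holomorphic_linear) (use assms in \<open>auto simp: X_bidisc_iff eigen2_def\<close>)
  then have "1 * F p + (-1) * G p = 0"
    by (rule bidisc_eq_0_of_restriction) (use assms(3) p in auto)
  then show "F p = G p" by simp
qed

lemma extension_map_eqI:
  assumes "F \<in> X_bidisc l" "\<And>z. z \<in> disc \<Longrightarrow> f z = F (z, cnj z)"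
  shows "extension_map l f = F"
  unfolding extension_map_def using assms
  by (intro the_equality X_bidisc_unique[of _ l F]) auto

lemma restrict_series_extension:
  assumes "f \<in> X_disc l" "expansion_coeffs l f c"
  shows "restrict (\<lambda>p. \<Sum>k. paired_mode l c k p) bidisc \<in> X_bidisc l"
    and "extension_map l f = restrict (\<lambda>p. \<Sum>k. paired_mode l c k p) bidisc"
proof -
  note e = eigen_extension[OF X_disc_imp_eigen[OF assms(1)] assms(2)]
  show X: "restrict (\<lambda>p. \<Sum>k. paired_mode l c k p) bidisc \<in> X_bidisc l"
    using e(1) unfolding X_bidisc_iff by (subst eigen2_cong[of _ "\<lambda>p. \<Sum>k. paired_mode l c k p"]) auto
  show "extension_map l f = restrict (\<lambda>p. \<Sum>k. paired_mode l c k p) bidisc"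
    by (rule extension_map_eqI[OF X]) (use e(2) in auto)
qed

lemma extension_map_X:
  assumes "f \<in> X_disc l"
  shows "extension_map l f \<in> X_bidisc l" and "\<And>z. z \<in> disc \<Longrightarrow> extension_map l f (z, cnj z) = f z"
proof -
  obtain c where c: "expansion_coeffs l f c" using expansion_coeffs_exist[OF X_disc_imp_eigen[OF assms]] by blast
  show "extension_map l f \<in> X_bidisc l" using restrict_series_extension[OF assms c] by simp
  show "\<And>z. z \<in> disc \<Longrightarrow> extension_map l f (z, cnj z) = f z"
    using restrict_series_extension(2)[OF assms c] eigen_extension(2)[OF X_disc_imp_eigen[OF assms] c] by simp
qed

text \<open>Summing the geometric majorant of the paired modes. Since \<open>C\<close> and
  \<open>R\<close> are fixed before \<open>f\<close>, this is continuity at 0 of a linear map, in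
  the form of a seminorm estimate.\<close>

lemma extension_map_bound:
  assumes r: "0 < r" "r < 1"
  shows "\<exists>C\<ge>0. \<exists>R<1. \<forall>f\<in>X_disc l. \<forall>M. (\<forall>z. cmod z \<le> R \<longrightarrow> cmod (f z) \<le> M) \<longrightarrow>
    (\<forall>p\<in>cball 0 r \<times> cball 0 r. cmod (extension_map l f p) \<le> C * M)"
proof -
  obtain C R where CR: "C \<ge> 0" "R > r" "R < 1" "\<And>f c M k p. continuous_on disc f \<Longrightarrow> expansion_coeffs l f c \<Longrightarrow>
      (\<And>z. cmod z \<le> R \<Longrightarrow> cmod (f z) \<le> M) \<Longrightarrow> p \<in> cball 0 r \<times> cball 0 r \<Longrightarrow>
      cmod (paired_mode l c k p) \<le> C * M * (r / R) ^ k"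
    using paired_mode_bound[OF r, of l] by blast
  have "cmod (extension_map l f p) \<le> C / (1 - r / R) * M"
    if f: "f \<in> X_disc l" and M: "\<And>z. cmod z \<le> R \<Longrightarrow> cmod (f z) \<le> M" and p: "p \<in> cball 0 r \<times> cball 0 r" for f M p
  proof -
    have e: "eigen l f" by (rule X_disc_imp_eigen[OF f])
    obtain c where c: "expansion_coeffs l f c" using expansion_coeffs_exist[OF e] by blast
    have "p \<in> bidisc" using p r by auto
    then have "extension_map l f p = (\<Sum>k. paired_mode l c k p)"
      using restrict_series_extension(2)[OF f c] by simp
    also have "cmod \<dots> \<le> (\<Sum>k. C * M * (r / R) ^ k)"
      by (rule norm_suminf_le[OF CR(4)[OF eigen_continuous_on[OF e] c M p]])
         (use r CR in \<open>auto intro!: summable_mult summable_geometric\<close>)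
    also have "\<dots> = C * M * (1 / (1 - r / R))"
      using r CR by (subst suminf_mult) (auto intro!: summable_geometric simp: suminf_geometric)
    finally show ?thesis by simp
  qed
  moreover have "C / (1 - r / R) \<ge> 0" using r CR by simp
  ultimately show ?thesis using CR(3) by blast
qed

lemma compact_bidisc_subset:
  assumes "compact K" "K \<subseteq> bidisc"
  shows "\<exists>r. 0 < r \<and> r < 1 \<and> K \<subseteq> cball 0 r \<times> cball 0 r"
proof (cases "K = {}")
  case True
  then show ?thesis by (intro exI[of _ "1/2"]) auto
next
  case False
  have "continuous_on K (\<lambda>p. max (cmod (fst p)) (cmod (snd p)))" by (intro continuous_intros)
  then obtain q where q: "q \<in> K" "\<And>p. p \<in> K \<Longrightarrow> max (cmod (fst p)) (cmod (snd p)) \<le> max (cmod (fst q)) (cmod (snd q))"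
    using continuous_attains_sup[OF assms(1) False] by blast
  have "max (cmod (fst q)) (cmod (snd q)) < 1" using q(1) assms(2) by force
  then show ?thesis
    using q(2) by (intro exI[of _ "max (1/2) (max (cmod (fst q)) (cmod (snd q)))"]) (force simp: le_max_iff_disj)
qed

text \<open>The combination is formed on the bidisc, where linearity of the equation is immediate.
  Its restriction lies in \<open>X_disc l\<close> and is the combination of \<open>f\<close> and
  \<open>g\<close>, so no second derivatives on the disc are combined, and uniqueness identifies the
  extension.\<close>

lemma extension_map_linear:
  assumes f: "f \<in> X_disc l" and g: "g \<in> X_disc l"
  shows "(\<lambda>z\<in>disc. a * f z + b * g z) \<in> X_disc l"
    and "extension_map l (\<lambda>z\<in>disc. a * f z + b * g z) =
           (\<lambda>p\<in>bidisc. a * extension_map l f p + b * extension_map l g p)"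
proof -
  define H where "H = (\<lambda>p\<in>bidisc. a * extension_map l f p + b * extension_map l g p)"
  have e: "eigen2 l (\<lambda>p. a * extension_map l f p + b * extension_map l g p)"
    by (rule eigen2_linear) (use extension_map_X(1)[OF f] extension_map_X(1)[OF g] in \<open>auto simp: X_bidisc_iff\<close>)
  then have H: "H \<in> X_bidisc l"
    unfolding X_bidisc_iff H_def
    by (subst eigen2_cong[of _ "\<lambda>p. a * extension_map l f p + b * extension_map l g p"]) auto
  have "(\<lambda>z\<in>disc. a * f z + b * g z) = (\<lambda>z\<in>disc. a * extension_map l f (z, cnj z) + b * extension_map l g (z, cnj z))"
    using extension_map_X(2)[OF f] extension_map_X(2)[OF g] by (auto intro!: restrict_ext)
  then show "(\<lambda>z\<in>disc. a * f z + b * g z) \<in> X_disc l"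
    using eigen2_imp_X_disc[OF e] by simp
  show "extension_map l (\<lambda>z\<in>disc. a * f z + b * g z) = (\<lambda>p\<in>bidisc. a * extension_map l f p + b * extension_map l g p)"
    using extension_map_eqI[OF H, of "\<lambda>z\<in>disc. a * f z + b * g z"] extension_map_X(2)[OF f] extension_map_X(2)[OF g]
    by (auto simp: H_def)
qed

text \<open>The inverse is restriction to \<open>w = cnj z\<close>: it recovers \<open>f\<close>
  from its extension, and it produces a preimage of any \<open>F\<close>.\<close>

lemma bij_betw_extension_map: "bij_betw (extension_map l) (X_disc l) (X_bidisc l)"
  unfolding bij_betw_def
proof (intro conjI inj_onI subset_antisym image_subsetI subsetI)
  fix f g assume f: "f \<in> X_disc l" and g: "g \<in> X_disc l" and eq: "extension_map l f = extension_map l g"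
  show "f = g"
  proof (rule extensionalityI[of _ disc])
    show "f \<in> extensional disc" "g \<in> extensional disc" using f g by (auto simp: X_disc_def C2_disc_def)
    show "f z = g z" if "z \<in> disc" for z
      using extension_map_X(2)[OF f that] extension_map_X(2)[OF g that] eq by simp
  qed
next
  fix F assume F: "F \<in> X_bidisc l"
  then have "(\<lambda>z\<in>disc. F (z, cnj z)) \<in> X_disc l" by (intro eigen2_imp_X_disc) (simp add: X_bidisc_iff)
  moreover have "extension_map l (\<lambda>z\<in>disc. F (z, cnj z)) = F" by (rule extension_map_eqI[OF F]) simp
  ultimately show "F \<in> extension_map l ` X_disc l" by force
qed (rule extension_map_X(1))

lemma continuous_map_extension_map:
  "continuous_map (locally_uniform_topology disc (X_disc l)) (locally_uniform_topology bidisc (X_bidisc l)) (extension_map l)"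
  unfolding continuous_map_def topspace_locally_uniform_topology
proof (intro conjI allI impI funcsetI)
  show "f \<in> X_disc l \<Longrightarrow> extension_map l f \<in> X_bidisc l" for f by (rule extension_map_X(1))
  fix U assume U: "openin (locally_uniform_topology bidisc (X_bidisc l)) U"
  show "openin (locally_uniform_topology disc (X_disc l)) {f \<in> X_disc l. extension_map l f \<in> U}"
    unfolding openin_locally_uniform_topology
  proof (intro conjI ballI)
    fix f assume "f \<in> {f \<in> X_disc l. extension_map l f \<in> U}"
    then have f: "f \<in> X_disc l" "extension_map l f \<in> U" by auto
    obtain K e where K: "compact K" "K \<subseteq> bidisc" "e > 0"
      "\<And>G. G \<in> X_bidisc l \<Longrightarrow> (\<And>p. p \<in> K \<Longrightarrow> dist (G p) (extension_map l f p) < e) \<Longrightarrow> G \<in> U"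
      using U f(2) unfolding openin_locally_uniform_topology by metis
    obtain r where r: "0 < r" "r < 1" "K \<subseteq> cball 0 r \<times> cball 0 r"
      using compact_bidisc_subset[OF K(1,2)] by blast
    obtain C R where CR: "C \<ge> 0" "R < 1" "\<And>f M p. f \<in> X_disc l \<Longrightarrow> (\<And>z. cmod z \<le> R \<Longrightarrow> cmod (f z) \<le> M) \<Longrightarrow>
      p \<in> cball 0 r \<times> cball 0 r \<Longrightarrow> cmod (extension_map l f p) \<le> C * M"
      using extension_map_bound[OF r(1,2), of l] by blast
    \<comment> \<open>With \<open>C + 1\<close> in the denominator, \<open>C * d < e\<close> holds
      also for \<open>C = 0\<close>.\<close>
    define d where "d = e / (C + 1)"
    have d: "d > 0" "C * d < e" using K(3) CR(1) by (auto simp: d_def field_simps)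
    have "extension_map l g \<in> U" if g: "g \<in> X_disc l" "\<And>z. z \<in> cball 0 R \<Longrightarrow> dist (g z) (f z) < d" for g
    proof (rule K(4)[OF extension_map_X(1)[OF g(1)]])
      fix p assume p: "p \<in> K"
      \<comment> \<open>Linearity turns the distance of two extensions into the size of the
        extension of \<open>g - f\<close>, to which the seminorm estimate applies.\<close>
      note lin = extension_map_linear[OF g(1) f(1), of 1 "-1"]
      have "cmod (extension_map l (\<lambda>z\<in>disc. 1 * g z + (-1) * f z) p) \<le> C * d"
        by (rule CR(3)[OF lin(1)]) (use g(2) CR(2) p r(3) in \<open>auto simp: dist_norm intro!: less_imp_le\<close>)
      moreover have "p \<in> bidisc" using p K(2) by auto
      ultimately show "dist (extension_map l g p) (extension_map l f p) < e"
        using d(2) unfolding lin(2) by (simp add: dist_norm)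
    qed
    then show "\<exists>K e. compact K \<and> K \<subseteq> disc \<and> e > 0 \<and>
        (\<forall>g\<in>X_disc l. (\<forall>z\<in>K. dist (g z) (f z) < e) \<longrightarrow> g \<in> {f \<in> X_disc l. extension_map l f \<in> U})"
      using CR(2) d(1) by (intro exI[of _ "cball 0 R"] exI[of _ d]) auto
  qed auto
qed

theorem theorem2p2:
  fixes l :: complex
  shows "(\<forall>f\<in>C2_disc. (\<forall>z\<in>disc. laplace_disc f z = l * f z) \<longrightarrow>
            (\<exists>!F. F \<in> H_bidisc \<and> (\<forall>p\<in>bidisc. laplace_zw F p = l * F p) \<and>
                  (\<forall>z\<in>disc. f z = F (z, cnj z)))) \<and>
         bij_betw (extension_map l) (X_disc l) (X_bidisc l) \<and>
         (\<forall>f\<in>X_disc l. \<forall>g\<in>X_disc l. \<forall>a b.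
            (\<lambda>z\<in>disc. a * f z + b * g z) \<in> X_disc l \<and>
            extension_map l (\<lambda>z\<in>disc. a * f z + b * g z) =
              (\<lambda>p\<in>bidisc. a * extension_map l f p + b * extension_map l g p)) \<and>
         continuous_map (locally_uniform_topology disc (X_disc l))
                        (locally_uniform_topology bidisc (X_bidisc l)) (extension_map l)"
proof (intro conjI ballI allI impI)
  fix f assume "f \<in> C2_disc" "\<forall>z\<in>disc. laplace_disc f z = l * f z"
  then have f: "f \<in> X_disc l" by (simp add: X_disc_def)
  have "\<exists>!F. F \<in> X_bidisc l \<and> (\<forall>z\<in>disc. f z = F (z, cnj z))"
    using extension_map_X[OF f] by (intro ex1I[of _ "extension_map l f"]) (auto intro: extension_map_eqI[symmetric])
  then show "\<exists>!F. F \<in> H_bidisc \<and> (\<forall>p\<in>bidisc. laplace_zw F p = l * F p) \<and> (\<forall>z\<in>disc. f z = F (z, cnj z))"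
    unfolding X_bidisc_def by (simp only: mem_Collect_eq conj_assoc)
qed (use extension_map_linear bij_betw_extension_map continuous_map_extension_map in auto)

end
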